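(* Let $V$ be the Voronoi tessellation determined by $\mathcal{S}\subset\mathbb{H}^2$ closed and discrete. For a vertex $v\in V^{(0)}$, the vertex polygon $P_v$ is non-centered if and only if $v$ is the initial vertex of a non-centered edge $e$ of $V$. If this is so, the geometric dual $\gamma$ to $e$ is the unique longest edge of $P_v$, and $P_v\cup T(e,v)$ is a convex polygon, where $T(e,v)$ is the triangle determined by $v$ and the endpoints $\partial\gamma$ of $\gamma$.
   Context: For $\mathcal S\subset\mathbb{H}^2$ closed and discrete and $x\in\mathcal S$, let $V_x=\{p\in\mathbb{H}^2 : d(p,x)\le d(p,y)\ \text{for all } y\in\mathcal S-\{x\}\}$, a convex polygon. The Voronoi tessellation $V$ has $2$-cells the $V_x$, edges the nondegenerate intersections $V_x\cap V_y$ ($x\neq y$), and vertices the points $V_x\cap V_y\cap V_z$ ($x,y,z$ distinct). The geometric dual to an edge $e=V_x\cap V_y$ is the geodesic arc $\gamma_{xy}$ joining $x$ to $y$ (note $e$ lies in the perpendicular bisector of $\gamma_{xy}$). For each $v\in V^{(0)}$ there is $J_v>0$ such that, for $x\in\mathcal S$, $v\in V_x$ iff $d(v,x)=J_v$. The vertex polygon $P_v$ is the compact convex polygon with vertex set $\{x\in\mathcal S: v\in V_x\}$; it is cyclic (its vertices are equidistant from a point, its center) with center $v$ and radius $J_v$, and its edges are the geometric duals to the edges of $V$ containing $v$. A cyclic polygon is centered if its center lies in its interior. An edge $e=V_x\cap V_y$ is centered if $e$ intersects $\gamma_{xy}$ at a point in the interior of $e$. A non-centered edge is oriented pointing away from $\gamma_{xy}$,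 so its initial vertex is its endpoint nearest to $\gamma_{xy}$. (If $v\in\gamma$ the triangle $T(e,v)$ is degenerate.) *)

theory Defs
  imports "HOL-Analysis.Analysis"
begin

section \<open>The hyperbolic plane\<close>

text \<open>The hyperboloid model: the upper sheet of the unit hyperboloid in Minkowski space, with
  the distance \<open>d\<close> of curvature \<open>-1\<close> given by \<open>cosh (d x y) = - \<langle>x, y\<rangle>\<close>.\<close>

definition minkowski :: "real^3 \<Rightarrow> real^3 \<Rightarrow> real" where
  "minkowski x y = x$1 * y$1 + x$2 * y$2 - x$3 * y$3"

typedef hyp_plane = "{x :: real^3. minkowski x x = -1 \<and> x$3 > 0}"
  by (rule exI[of _ "vector [0, 0, 1]"]) (simp add: minkowski_def)

lemma minkowski_commute: "minkowski x y = minkowski y x"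
  by (simp add: minkowski_def algebra_simps)

lemma minkowski_Rep_self [simp]: "minkowski (Rep_hyp_plane x) (Rep_hyp_plane x) = -1"
  using Rep_hyp_plane[of x] by simp

lemma Rep_hyp_plane_pos: "Rep_hyp_plane x $ 3 > 0"
  using Rep_hyp_plane[of x] by simp

lemma minkowski_Rep_le: "minkowski (Rep_hyp_plane x) (Rep_hyp_plane y) \<le> -1"
  and minkowski_Rep_eq_iff:
    "minkowski (Rep_hyp_plane x) (Rep_hyp_plane y) = -1 \<longleftrightarrow> x = y"
proof -
  define a b c where "a = Rep_hyp_plane x $ 1" and "b = Rep_hyp_plane x $ 2"
    and "c = Rep_hyp_plane x $ 3"
  define a' b' c' where "a' = Rep_hyp_plane y $ 1" and "b' = Rep_hyp_plane y $ 2"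
    and "c' = Rep_hyp_plane y $ 3"
  note defs = a_def b_def c_def a'_def b'_def c'_def
  have c: "c\<^sup>2 = 1 + a\<^sup>2 + b\<^sup>2" "c'\<^sup>2 = 1 + a'\<^sup>2 + b'\<^sup>2" "c > 0" "c' > 0"
    using minkowski_Rep_self[of x] minkowski_Rep_self[of y] Rep_hyp_plane_pos[of x]
      Rep_hyp_plane_pos[of y]
    by (simp_all add: minkowski_def defs power2_eq_square)
  have eq: "(c * c')\<^sup>2 - (1 + a * a' + b * b')\<^sup>2
      = (a - a')\<^sup>2 + (b - b')\<^sup>2 + (a * b' - b * a')\<^sup>2"
    unfolding power_mult_distrib c(1,2) by (simp add: power2_eq_square algebra_simps)
  have "0 \<le> (c * c')\<^sup>2 - (1 + a * a' + b * b')\<^sup>2"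
    unfolding eq by simp
  then have "(1 + a * a' + b * b')\<^sup>2 \<le> (c * c')\<^sup>2"
    by simp
  then have "1 + a * a' + b * b' \<le> c * c'"
    by (rule power2_le_imp_le) (use c(3,4) in simp)
  then show "minkowski (Rep_hyp_plane x) (Rep_hyp_plane y) \<le> -1"
    by (simp add: minkowski_def defs)
  show "minkowski (Rep_hyp_plane x) (Rep_hyp_plane y) = -1 \<longleftrightarrow> x = y"
  proof
    assume "minkowski (Rep_hyp_plane x) (Rep_hyp_plane y) = -1"
    then have "c * c' = 1 + a * a' + b * b'"
      by (simp add: minkowski_def defs)
    with eq have "(a - a')\<^sup>2 + (b - b')\<^sup>2 + (a * b' - b * a')\<^sup>2 = 0"
      by simp
    then have ab: "a = a'" "b = b'"
      by (simp_all add: add_nonneg_eq_0_iff)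
    then have "c\<^sup>2 = c'\<^sup>2"
      by (simp only: c(1,2))
    then have "c = c'"
      by (rule power2_eq_imp_eq) (use c(3,4) in simp_all)
    with ab have "Rep_hyp_plane x = Rep_hyp_plane y"
      by (simp add: vec_eq_iff forall_3 defs)
    then show "x = y"
      by (simp add: Rep_hyp_plane_inject)
  qed simp
qed

text \<open>The square of the determinant of three vectors is minus their Minkowski Gram determinant.\<close>

lemma minkowski_gram:
  "minkowski x x * minkowski y y * minkowski z z + 2 * minkowski x y * minkowski y z * minkowski x z
     - minkowski x x * (minkowski y z)\<^sup>2 - minkowski y y * (minkowski x z)\<^sup>2
     - minkowski z z * (minkowski x y)\<^sup>2
   = - (x$1 * (y$2 * z$3 - y$3 * z$2) - x$2 * (y$1 * z$3 - y$3 * z$1)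
        + x$3 * (y$1 * z$2 - y$2 * z$1))\<^sup>2"
  unfolding minkowski_def by algebra

lemma hyp_plane_triangle:
  fixes x y z :: hyp_plane
  defines "d \<equiv> \<lambda>x y. arcosh (- minkowski (Rep_hyp_plane x) (Rep_hyp_plane y))"
  shows "d x z \<le> d x y + d y z"
proof -
  define a b c where "a = - minkowski (Rep_hyp_plane x) (Rep_hyp_plane y)"
    and "b = - minkowski (Rep_hyp_plane y) (Rep_hyp_plane z)"
    and "c = - minkowski (Rep_hyp_plane x) (Rep_hyp_plane z)"
  have ge: "a \<ge> 1" "b \<ge> 1" "c \<ge> 1"
    using minkowski_Rep_le[of x y] minkowski_Rep_le[of y z] minkowski_Rep_le[of x z]
    by (simp_all add: a_def b_def c_def)
  have "-1 - 2 * a * b * c + b\<^sup>2 + c\<^sup>2 + a\<^sup>2 \<le> 0"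
    using minkowski_gram[of "Rep_hyp_plane x" "Rep_hyp_plane y" "Rep_hyp_plane z"]
    by (simp add: a_def b_def c_def)
  then have "(c - a * b)\<^sup>2 \<le> (a\<^sup>2 - 1) * (b\<^sup>2 - 1)"
    by (simp add: power2_eq_square algebra_simps)
  then have "c - a * b \<le> sqrt ((a\<^sup>2 - 1) * (b\<^sup>2 - 1))"
    by (rule real_le_rsqrt)
  also have "\<dots> = sinh (arcosh a) * sinh (arcosh b)"
    using ge by (simp add: real_sqrt_mult sinh_arcosh_real)
  finally have "c \<le> cosh (arcosh a + arcosh b)"
    using ge by (simp add: cosh_add)
  then have "cosh (arcosh c) \<le> cosh (arcosh a + arcosh b)"
    using ge by simp
  then have "arcosh c \<le> arcosh a + arcosh b"
    using ge by (subst (asm) cosh_real_nonneg_le_iff) auto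
  then show ?thesis
    by (simp add: d_def a_def b_def c_def)
qed

instantiation hyp_plane :: metric_space
begin

definition dist_hyp_plane :: "hyp_plane \<Rightarrow> hyp_plane \<Rightarrow> real" where
  "dist_hyp_plane x y = arcosh (- minkowski (Rep_hyp_plane x) (Rep_hyp_plane y))"

definition uniformity_hyp_plane :: "(hyp_plane \<times> hyp_plane) filter" where
  "uniformity_hyp_plane = (INF e\<in>{0<..}. principal {(x, y). dist x y < e})"

definition open_hyp_plane :: "hyp_plane set \<Rightarrow> bool" where
  "open_hyp_plane U \<longleftrightarrow> (\<forall>x\<in>U. eventually (\<lambda>(x', y). x' = x \<longrightarrow> y \<in> U) uniformity)"

instance
proof
  fix x y z :: hyp_plane
  show "dist x y = 0 \<longleftrightarrow> x = y"
    unfolding dist_hyp_plane_def using minkowski_Rep_le[of x y] minkowski_Rep_eq_iff[of x y]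
    by (subst arcosh_eq_0_iff_real) auto
  show "dist x y \<le> dist x z + dist y z"
    using hyp_plane_triangle[of x y z] minkowski_commute[of "Rep_hyp_plane y"]
    by (simp add: dist_hyp_plane_def)
qed (simp_all add: uniformity_hyp_plane_def open_hyp_plane_def)

end


section \<open>Geodesics, convexity and polygons\<close>

text \<open>In the hyperbolic plane a point lies on the geodesic arc joining \<open>x\<close> to \<open>y\<close> exactly if it
  gives equality in the triangle inequality.\<close>

definition geodesic_arc :: "hyp_plane \<Rightarrow> hyp_plane \<Rightarrow> hyp_plane set" where
  "geodesic_arc x y = {p. dist x p + dist p y = dist x y}"

definition hyp_convex :: "hyp_plane set \<Rightarrow> bool" where
  "hyp_convex C \<longleftrightarrow> (\<forall>a\<in>C. \<forall>b\<in>C. geodesic_arc a b \<subseteq> C)"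

abbreviation hyp_convex_hull :: "hyp_plane set \<Rightarrow> hyp_plane set" where
  "hyp_convex_hull A \<equiv> hyp_convex hull A"

text \<open>Applied to a convex polygon, \<open>extreme_points\<close> gives its vertices; applied to a geodesic arc,
  ray or line, it gives its endpoints (none for a line).\<close>

definition extreme_points :: "hyp_plane set \<Rightarrow> hyp_plane set" where
  "extreme_points C = {p \<in> C. \<forall>a\<in>C. \<forall>b\<in>C. p \<in> geodesic_arc a b \<longrightarrow> p = a \<or> p = b}"

definition compact_convex_polygon :: "hyp_plane set \<Rightarrow> bool" where
  "compact_convex_polygon P \<longleftrightarrow>
     (\<exists>F. finite F \<and> P = hyp_convex_hull F) \<and> interior P \<noteq> {}"

text \<open>The geodesic arc from \<open>a\<close> to \<open>b\<close> is an edge of the polygon \<open>P\<close>.\<close>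

definition polygon_edge :: "hyp_plane set \<Rightarrow> hyp_plane \<Rightarrow> hyp_plane \<Rightarrow> bool" where
  "polygon_edge P a b \<longleftrightarrow>
     a \<in> extreme_points P \<and> b \<in> extreme_points P \<and> a \<noteq> b \<and> geodesic_arc a b \<subseteq> frontier P"

definition unique_longest_edge :: "hyp_plane set \<Rightarrow> hyp_plane \<Rightarrow> hyp_plane \<Rightarrow> bool" where
  "unique_longest_edge P x y \<longleftrightarrow>
     polygon_edge P x y \<and> (\<forall>a b. polygon_edge P a b \<and> {a, b} \<noteq> {x, y} \<longrightarrow> dist a b < dist x y)"

definition is_centre :: "hyp_plane set \<Rightarrow> hyp_plane \<Rightarrow> bool" where
  "is_centre P c \<longleftrightarrow> (\<exists>r. \<forall>x\<in>extreme_points P. dist c x = r)"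

definition cyclic_polygon :: "hyp_plane set \<Rightarrow> bool" where
  "cyclic_polygon P \<longleftrightarrow> compact_convex_polygon P \<and> (\<exists>c. is_centre P c)"

definition centered_polygon :: "hyp_plane set \<Rightarrow> bool" where
  "centered_polygon P \<longleftrightarrow> cyclic_polygon P \<and> (\<exists>c. is_centre P c \<and> c \<in> interior P)"

definition noncentered_polygon :: "hyp_plane set \<Rightarrow> bool" where
  "noncentered_polygon P \<longleftrightarrow> cyclic_polygon P \<and> \<not> centered_polygon P"


section \<open>The Voronoi tessellation\<close>

definition voronoi_cell :: "hyp_plane set \<Rightarrow> hyp_plane \<Rightarrow> hyp_plane set" where
  "voronoi_cell S x = {p. \<forall>y\<in>S - {x}. dist p x \<le> dist p y}"

definition voronoi_vertices :: "hyp_plane set \<Rightarrow> hyp_plane set" where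
  "voronoi_vertices S = {v. \<exists>x\<in>S. \<exists>y\<in>S. \<exists>z\<in>S. x \<noteq> y \<and> y \<noteq> z \<and> x \<noteq> z \<and>
     voronoi_cell S x \<inter> voronoi_cell S y \<inter> voronoi_cell S z = {v}}"

text \<open>\<open>geometric_dual S e x y\<close>: \<open>e\<close> is the edge \<open>V\<^sub>x \<inter> V\<^sub>y\<close> of the tessellation, so its geometric
  dual is the geodesic arc joining \<open>x\<close> to \<open>y\<close>. Nondegenerate means having more than one point.\<close>

definition geometric_dual ::
    "hyp_plane set \<Rightarrow> hyp_plane set \<Rightarrow> hyp_plane \<Rightarrow> hyp_plane \<Rightarrow> bool" where
  "geometric_dual S e x y \<longleftrightarrow> x \<in> S \<and> y \<in> S \<and> x \<noteq> y \<and>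
     e = voronoi_cell S x \<inter> voronoi_cell S y \<and> (\<exists>p\<in>e. \<exists>q\<in>e. p \<noteq> q)"

definition voronoi_edges :: "hyp_plane set \<Rightarrow> hyp_plane set set" where
  "voronoi_edges S = {e. \<exists>x y. geometric_dual S e x y}"

text \<open>The interior of an edge, as a 1-cell, is the complement of its endpoints.\<close>

definition centered_edge :: "hyp_plane set \<Rightarrow> hyp_plane set \<Rightarrow> bool" where
  "centered_edge S e \<longleftrightarrow>
     (\<exists>x y. geometric_dual S e x y \<and> (e - extreme_points e) \<inter> geodesic_arc x y \<noteq> {})"

definition noncentered_edge :: "hyp_plane set \<Rightarrow> hyp_plane set \<Rightarrow> bool" where
  "noncentered_edge S e \<longleftrightarrow> e \<in> voronoi_edges S \<and> \<not> centered_edge S e"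

text \<open>Meaningful for non-centered edges: \<open>v\<close> is the endpoint of \<open>e\<close> nearest to its geometric
  dual.\<close>

definition initial_vertex :: "hyp_plane set \<Rightarrow> hyp_plane set \<Rightarrow> hyp_plane \<Rightarrow> bool" where
  "initial_vertex S e v \<longleftrightarrow> (\<exists>x y. geometric_dual S e x y \<and> v \<in> extreme_points e \<and>
     (\<forall>w\<in>extreme_points e. infdist v (geodesic_arc x y) \<le> infdist w (geodesic_arc x y)))"

definition vertex_polygon :: "hyp_plane set \<Rightarrow> hyp_plane \<Rightarrow> hyp_plane set" where
  "vertex_polygon S v = hyp_convex_hull {x\<in>S. v \<in> voronoi_cell S x}"

text \<open>The triangle \<open>T(e, v)\<close>, where the geometric dual to \<open>e\<close> joins \<open>x\<close> to \<open>y\<close>; degenerate if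
  \<open>v\<close> lies on that arc.\<close>

definition dual_triangle :: "hyp_plane \<Rightarrow> hyp_plane \<Rightarrow> hyp_plane \<Rightarrow> hyp_plane set" where
  "dual_triangle x y v = hyp_convex_hull {v, x, y}"

end

theory Submission
  imports Defs
begin

text \<open>Everything is read off in the Klein disc centred at \<open>v\<close>. There geodesic arcs are segments, the
  sites whose cells contain \<open>v\<close> lie on a circle about the origin, the vertex polygon is their Euclidean
  convex hull, and the perpendicular bisectors of pairs of these sites are lines through the origin.
  So the edges of \<open>V\<close> at \<open>v\<close> correspond to the sides of the polygon: the edge dual to a side with outer
  unit normal \<open>n\<close>, on the line \<open>n \<bullet> z = h\<close>, starts at \<open>0\<close> in the direction \<open>n\<close>, and its bisector meets
  the side at \<open>h *\<^sub>R n\<close>. Hence \<open>v\<close> is the initial vertex of a non-centered edge exactly if \<open>h \<le> 0\<close>,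
  that is, if the side weakly separates the polygon from its centre. All sites then lie on an arc of at
  most half the circle whose chord is that side, which makes it the unique longest one.\<close>

section \<open>The Klein disc centred at a point\<close>

text \<open>Distances mostly enter through \<open>cosh\<close>, which is bilinear on the
  hyperboloid. This is why central projection straightens arcs; and with \<open>v\<close> as centre
  all sites at \<open>v\<close> share one factor, so that comparing distances to them is comparing
  inner products. No cyclic order of the sites is used: a side is a unit vector whose maximum over
  the sites is attained at two of them. Two steps are not formal. If the centre is not interior,
  separation gives only a line through the centre, which need not contain a side; a suitable side is
  spanned by the two sites farthest apart along that line. Conversely, an initial vertex is known
  only by comparison with other endpoints of the edge, and an edge may be unbounded or stop short of
  its dual arc; for \<open>h > 0\<close> a nearer endpoint has to be produced.\<close>

lemma cosh_dist: "cosh (dist x y) = - minkowski (Rep_hyp_plane x) (Rep_hyp_plane y)"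
  using minkowski_Rep_le[of x y] by (simp add: dist_hyp_plane_def)

lemma cosh_dist_ge_1: "cosh (dist x y) \<ge> 1" for x y :: hyp_plane
  by (rule cosh_real_ge_1)

lemma dist_le_iff_cosh: "dist x y \<le> dist x' y' \<longleftrightarrow> cosh (dist x y) \<le> cosh (dist x' y')"
  for x y x' y' :: hyp_plane
  by (simp add: cosh_real_nonneg_le_iff)

lemma dist_less_iff_cosh: "dist x y < dist x' y' \<longleftrightarrow> cosh (dist x y) < cosh (dist x' y')"
  for x y x' y' :: hyp_plane
  by (simp add: cosh_real_nonneg_less_iff)

lemma minkowski_lincomb:
  "minkowski (a *\<^sub>R x + b *\<^sub>R y) z = a * minkowski x z + b * minkowski y z"
  "minkowski z (a *\<^sub>R x + b *\<^sub>R y) = a * minkowski z x + b * minkowski z y"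
  by (simp_all add: minkowski_def algebra_simps)

text \<open>Equality in the reversed Cauchy-Schwarz inequality. A point is thus identified by two
  Minkowski products and a sign, without solving for coordinates.\<close>

lemma Rep_hyp_plane_eqI:
  assumes "minkowski q q = -1" "q $ 3 > 0" "minkowski (Rep_hyp_plane p) q = -1"
  shows "Rep_hyp_plane p = q"
proof -
  have "Rep_hyp_plane (Abs_hyp_plane q) = q"
    using assms by (intro Abs_hyp_plane_inverse) simp
  then show ?thesis
    using assms minkowski_Rep_eq_iff[of p "Abs_hyp_plane q"] by simp
qed

text \<open>The cone spanned by two points cuts the sheet in their geodesic arc. Forwards, the
  weights are the hyperbolic analogue of spherical linear interpolation; backwards,
  \<open>cosh\<close> and \<open>sinh\<close> of both partial distances are explicit in
  \<open>a\<close> and \<open>b\<close>, and the addition formula gives back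
  \<open>cosh (dist x y)\<close>.\<close>

lemma geodesic_arc_iff_cone:
  "p \<in> geodesic_arc x y \<longleftrightarrow>
     (\<exists>a\<ge>0. \<exists>b\<ge>0. Rep_hyp_plane p = a *\<^sub>R Rep_hyp_plane x + b *\<^sub>R Rep_hyp_plane y)"
proof
  assume "p \<in> geodesic_arc x y"
  then have sum: "dist x y = dist x p + dist p y"
    by (simp add: geodesic_arc_def)
  show "\<exists>a\<ge>0. \<exists>b\<ge>0. Rep_hyp_plane p = a *\<^sub>R Rep_hyp_plane x + b *\<^sub>R Rep_hyp_plane y"
  proof (cases "x = y")
    case True
    with sum have "p = x"
      by (simp add: dist_commute)
    then show ?thesis
      by (intro exI[of _ 1] conjI exI[of _ 0]) simp_all
  next
    case False
    define A B where "A = dist x p" and "B = dist p y"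
    define a b where "a = sinh B / sinh (A + B)" and "b = sinh A / sinh (A + B)"
    define q where "q = a *\<^sub>R Rep_hyp_plane x + b *\<^sub>R Rep_hyp_plane y"
    have nonneg: "A \<ge> 0" "B \<ge> 0" and pos: "A + B > 0"
      using False sum by (simp_all add: A_def B_def flip: sum)
    have s: "sinh (A + B) > 0"
      using pos by simp
    have ab: "a \<ge> 0" "b \<ge> 0"
      using nonneg s by (simp_all add: a_def b_def)
    have "a \<noteq> 0 \<or> b \<noteq> 0"
      using nonneg pos s by (auto simp: a_def b_def)
    then have q3: "q $ 3 > 0"
      using ab Rep_hyp_plane_pos[of x] Rep_hyp_plane_pos[of y]
      by (auto simp: q_def intro: add_pos_nonneg add_nonneg_pos)
    have mxy: "minkowski (Rep_hyp_plane x) (Rep_hyp_plane y) = - cosh (A + B)"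
        "minkowski (Rep_hyp_plane y) (Rep_hyp_plane x) = - cosh (A + B)"
        "minkowski (Rep_hyp_plane p) (Rep_hyp_plane x) = - cosh A"
        "minkowski (Rep_hyp_plane p) (Rep_hyp_plane y) = - cosh B"
      using cosh_dist[of x y] cosh_dist[of y x] cosh_dist[of p x] cosh_dist[of p y] sum
      by (simp_all add: A_def B_def dist_commute)
    have "minkowski (Rep_hyp_plane p) q = - (a * cosh A + b * cosh B)"
      by (simp add: q_def minkowski_lincomb mxy)
    also have "a * cosh A + b * cosh B = sinh (A + B) / sinh (A + B)"
    proof -
      have "a * cosh A + b * cosh B = (sinh A * cosh B + cosh A * sinh B) / sinh (A + B)"
        by (simp add: a_def b_def add_divide_distrib mult.commute)
      then show ?thesis
        by (simp add: sinh_add)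
    qed
    finally have pq: "minkowski (Rep_hyp_plane p) q = -1"
      using s by simp
    have eq: "(sinh A)\<^sup>2 + (sinh B)\<^sup>2 + 2 * sinh A * sinh B * cosh (A + B) = (sinh (A + B))\<^sup>2"
      using hyperbolic_pythagoras[of A] hyperbolic_pythagoras[of B]
      unfolding sinh_add cosh_add by algebra
    have "minkowski q q = - (a\<^sup>2 + b\<^sup>2 + 2 * a * b * cosh (A + B))"
      by (simp add: q_def minkowski_lincomb mxy algebra_simps power2_eq_square)
    also have "a\<^sup>2 + b\<^sup>2 + 2 * a * b * cosh (A + B)
        = ((sinh A)\<^sup>2 + (sinh B)\<^sup>2 + 2 * sinh A * sinh B * cosh (A + B)) / (sinh (A + B))\<^sup>2"
      using s by (simp add: a_def b_def field_simps power2_eq_square)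
    also have "\<dots> = 1"
      unfolding eq using s by simp
    finally have "minkowski q q = -1" .
    from Rep_hyp_plane_eqI[OF this q3 pq] ab show ?thesis
      unfolding q_def by blast
  qed
next
  assume "\<exists>a\<ge>0. \<exists>b\<ge>0. Rep_hyp_plane p = a *\<^sub>R Rep_hyp_plane x + b *\<^sub>R Rep_hyp_plane y"
  then obtain a b where ab: "a \<ge> 0" "b \<ge> 0"
    and p: "Rep_hyp_plane p = a *\<^sub>R Rep_hyp_plane x + b *\<^sub>R Rep_hyp_plane y"
    by blast
  define c where "c = cosh (dist x y)"
  have mxy: "minkowski (Rep_hyp_plane x) (Rep_hyp_plane y) = - c"
      "minkowski (Rep_hyp_plane y) (Rep_hyp_plane x) = - c"
    using cosh_dist[of x y] by (simp_all add: c_def minkowski_commute)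
  have xp: "cosh (dist x p) = a + b * c"
    by (simp add: cosh_dist p minkowski_lincomb mxy)
  have py: "cosh (dist p y) = a * c + b"
    by (simp add: cosh_dist p minkowski_lincomb mxy)
  have "minkowski (Rep_hyp_plane p) (Rep_hyp_plane p) = -1"
    by simp
  then have one: "a\<^sup>2 + b\<^sup>2 + 2 * a * b * c = 1"
    unfolding p by (simp add: minkowski_lincomb mxy algebra_simps power2_eq_square)
  have "(sinh (dist x p))\<^sup>2 = (b * sinh (dist x y))\<^sup>2"
    using one by (simp add: sinh_square_eq xp power_mult_distrib flip: c_def) algebra
  then have sxp: "sinh (dist x p) = b * sinh (dist x y)"
    by (rule power2_eq_imp_eq) (use ab in simp_all)
  have "(sinh (dist p y))\<^sup>2 = (a * sinh (dist x y))\<^sup>2"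
    using one by (simp add: sinh_square_eq py power_mult_distrib flip: c_def) algebra
  then have spy: "sinh (dist p y) = a * sinh (dist x y)"
    by (rule power2_eq_imp_eq) (use ab in simp_all)
  have "cosh (dist x p + dist p y) = (a + b * c) * (a * c + b) + a * b * (sinh (dist x y))\<^sup>2"
    by (simp add: cosh_add xp py sxp spy power2_eq_square)
  also have "\<dots> = c"
    using one unfolding sinh_square_eq c_def[symmetric] by algebra
  finally have "dist x p + dist p y = dist x y"
    unfolding c_def by (metis abs_of_nonneg add_nonneg_nonneg arcosh_cosh_real zero_le_dist)
  then show "p \<in> geodesic_arc x y"
    by (simp add: geodesic_arc_def)
qed

text \<open>The \<open>v\<close>-orthogonal component of a vector, in an orthonormal frame: the Lorentz boost that moves \<open>v\<close>
  to \<open>(0, 0, 1)\<close>, followed by the projection to the first two coordinates.\<close>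

definition boost :: "hyp_plane \<Rightarrow> real^3 \<Rightarrow> complex" where
  "boost v x = (let a = Rep_hyp_plane v $ 1; b = Rep_hyp_plane v $ 2; c = Rep_hyp_plane v $ 3;
     s = (a * x$1 + b * x$2) / (1 + c) - x$3 in Complex (x$1 + a * s) (x$2 + b * s))"

text \<open>Central projection: after the boost, \<open>cosh (dist v p)\<close> is the third
  coordinate, and dividing by it moves the point to the plane at height \<open>1\<close>.\<close>

definition klein :: "hyp_plane \<Rightarrow> hyp_plane \<Rightarrow> complex" where
  "klein v p = boost v (Rep_hyp_plane p) /\<^sub>R cosh (dist v p)"

lemma boost_lincomb: "boost v (a *\<^sub>R x + b *\<^sub>R y) = a *\<^sub>R boost v x + b *\<^sub>R boost v y"
  using Rep_hyp_plane_pos[of v]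
  by (simp add: boost_def Let_def complex_eq_iff add_divide_distrib algebra_simps)

text \<open>The boost preserves the Minkowski form, and its third coordinate is the product with
  \<open>v\<close> up to sign, so \<open>boost\<close> need not carry it.\<close>

lemma minkowski_boost:
  "minkowski x y = boost v x \<bullet> boost v y
     - minkowski (Rep_hyp_plane v) x * minkowski (Rep_hyp_plane v) y"
proof -
  define a b c where "a = Rep_hyp_plane v $ 1" and "b = Rep_hyp_plane v $ 2"
    and "c = Rep_hyp_plane v $ 3"
  have c: "a\<^sup>2 + b\<^sup>2 = (c - 1) * (1 + c)" "1 + c \<noteq> 0"
    using minkowski_Rep_self[of v] Rep_hyp_plane_pos[of v]
    by (auto simp: minkowski_def a_def b_def c_def power2_eq_square algebra_simps)
  define s t where "s = (a * x$1 + b * x$2) / (1 + c)" and "t = (a * y$1 + b * y$2) / (1 + c)"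
  have st: "a * x$1 + b * x$2 = s * (1 + c)" "a * y$1 + b * y$2 = t * (1 + c)"
    using c by (simp_all add: s_def t_def)
  have "boost v x \<bullet> boost v y = (x$1 + a * (s - x$3)) * (y$1 + a * (t - y$3))
      + (x$2 + b * (s - x$3)) * (y$2 + b * (t - y$3))"
    by (simp add: boost_def Let_def inner_complex_def a_def b_def c_def s_def t_def)
  also have "\<dots> = x$1 * y$1 + x$2 * y$2 + s * (1 + c) * (t - y$3) + t * (1 + c) * (s - x$3)
      + (c - 1) * (1 + c) * (s - x$3) * (t - y$3)"
    using st c(1) by algebra
  also have "\<dots> - (s * (1 + c) - c * x$3) * (t * (1 + c) - c * y$3) = minkowski x y"
    by (simp add: minkowski_def algebra_simps power2_eq_square)
  finally show ?thesis
    by (simp add: minkowski_def st flip: a_def b_def c_def)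
qed

context
  fixes v :: hyp_plane
begin

lemma boost_Rep: "boost v (Rep_hyp_plane p) = cosh (dist v p) *\<^sub>R klein v p"
  by (simp add: klein_def)

text \<open>The hyperbolic law of cosines: the inner product is
  \<open>tanh (dist v p) * tanh (dist v q)\<close> times the cosine of the angle at \<open>v\<close>.\<close>

lemma cosh_dist_klein:
  "cosh (dist p q) = cosh (dist v p) * cosh (dist v q) * (1 - klein v p \<bullet> klein v q)"
proof -
  have "cosh (dist p q) = cosh (dist v p) * cosh (dist v q)
      - boost v (Rep_hyp_plane p) \<bullet> boost v (Rep_hyp_plane q)"
    unfolding cosh_dist minkowski_boost[of "Rep_hyp_plane p" "Rep_hyp_plane q" v] by simp
  then show ?thesis
    by (simp add: boost_Rep algebra_simps)
qed

text \<open>The law of cosines at \<open>q = p\<close>; equivalently,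
  \<open>norm (klein v p) = tanh (dist v p)\<close>.\<close>

lemma cosh_dist_norm_klein: "(cosh (dist v p))\<^sup>2 * (1 - (norm (klein v p))\<^sup>2) = 1"
  using cosh_dist_klein[of p p] by (simp add: power2_eq_square flip: power2_norm_eq_inner)

lemma norm_klein_less_1: "norm (klein v p) < 1"
proof -
  have "1 - (norm (klein v p))\<^sup>2 > 0"
    using cosh_dist_norm_klein[of p] 
    by (metis not_one_le_zero order_less_le_trans zero_less_mult_pos zero_less_one cosh_real_pos zero_less_power)
  then show ?thesis
    by (simp add: power_less_one_iff abs_square_less_1)
qed

lemma klein_self [simp]: "klein v v = 0"
  using cosh_dist_norm_klein[of v] by simp

lemma inj_klein: "inj (klein v)"
proof
  fix p q assume eq: "klein v p = klein v q"
  have "(cosh (dist v p))\<^sup>2 = (cosh (dist v q))\<^sup>2"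
    using cosh_dist_norm_klein[of p] cosh_dist_norm_klein[of q] eq
    by (metis mult_cancel_right mult_zero_right zero_neq_one)
  then have "cosh (dist v p) = cosh (dist v q)"
    by (rule power2_eq_imp_eq) simp_all
  then have "cosh (dist p q) = 1"
    using cosh_dist_klein[of p q] cosh_dist_klein[of p p] eq by simp
  then show "p = q"
    by simp
qed

lemma klein_eq_iff [simp]: "klein v p = klein v q \<longleftrightarrow> p = q"
  using inj_klein by (auto dest: injD)

lemma klein_eq_0_iff [simp]: "klein v p = 0 \<longleftrightarrow> p = v"
  using klein_eq_iff[of p v] by simp

text \<open>Projection takes the cone over \<open>x\<close> and \<open>y\<close> to a segment, with
  weights renormalised by the third coordinates. Conversely, the combination \<open>q\<close> with
  the rescaled weights has the same boost and the same product with \<open>v\<close> as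
  \<open>p\<close>, hence equals it.\<close>

lemma klein_geodesic_arc_iff:
  "p \<in> geodesic_arc x y \<longleftrightarrow> klein v p \<in> closed_segment (klein v x) (klein v y)"
proof
  define X Y P where "X = cosh (dist v x)" and "Y = cosh (dist v y)" and "P = cosh (dist v p)"
  have pos: "X > 0" "Y > 0" "P > 0"
    by (simp_all add: X_def Y_def P_def)
  {
    assume "p \<in> geodesic_arc x y"
    then obtain a b where ab: "a \<ge> 0" "b \<ge> 0"
      and p: "Rep_hyp_plane p = a *\<^sub>R Rep_hyp_plane x + b *\<^sub>R Rep_hyp_plane y"
      by (auto simp: geodesic_arc_iff_cone)
    have P: "P = a * X + b * Y"
      by (simp add: X_def Y_def P_def cosh_dist p minkowski_lincomb)
    have "P *\<^sub>R klein v p = (a * X) *\<^sub>R klein v x + (b * Y) *\<^sub>R klein v y"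
      using boost_Rep[of p] boost_Rep[of x] boost_Rep[of y]
      by (simp add: p boost_lincomb X_def Y_def P_def)
    then have "klein v p = (a * X / P) *\<^sub>R klein v x + (b * Y / P) *\<^sub>R klein v y"
      using pos by (metis (no_types, lifting) divide_inverse_commute eq_vector_fraction_iff
          less_irrefl scaleR_right_distrib scaleR_scaleR)
    moreover have "a * X / P + b * Y / P = 1"
      using pos P by (simp flip: add_divide_distrib)
    moreover have "a * X / P \<ge> 0" "b * Y / P \<ge> 0"
      using ab pos by simp_all
    ultimately show "klein v p \<in> closed_segment (klein v x) (klein v y)"
      unfolding segment_convex_hull convex_hull_2 by blast
  }
  {
    assume "klein v p \<in> closed_segment (klein v x) (klein v y)"
    then obtain t where t: "0 \<le> t" "t \<le> 1"
      and p: "klein v p = (1 - t) *\<^sub>R klein v x + t *\<^sub>R klein v y"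
      by (auto simp: closed_segment_def)
    define a b where "a = (1 - t) * P / X" and "b = t * P / Y"
    define q where "q = a *\<^sub>R Rep_hyp_plane x + b *\<^sub>R Rep_hyp_plane y"
    have ab: "a \<ge> 0" "b \<ge> 0"
      using t pos by (simp_all add: a_def b_def)
    have "a \<noteq> 0 \<or> b \<noteq> 0"
      using t pos by (auto simp: a_def b_def)
    then have q3: "q $ 3 > 0"
      using ab Rep_hyp_plane_pos[of x] Rep_hyp_plane_pos[of y]
      by (auto simp: q_def intro: add_pos_nonneg add_nonneg_pos)
    have boost: "boost v q = boost v (Rep_hyp_plane p)"
      using pos unfolding q_def boost_lincomb boost_Rep p X_def[symmetric] Y_def[symmetric]
        P_def[symmetric] by (simp add: a_def b_def scaleR_right_distrib mult.commute)
    have "minkowski (Rep_hyp_plane v) q = - (a * X + b * Y)"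
      by (simp add: q_def minkowski_lincomb X_def Y_def cosh_dist)
    also have "a * X + b * Y = P"
      using pos by (simp add: a_def b_def left_diff_distrib diff_divide_distrib)
    finally have height: "minkowski (Rep_hyp_plane v) q
        = minkowski (Rep_hyp_plane v) (Rep_hyp_plane p)"
      by (simp add: P_def cosh_dist)
    have "minkowski q q = minkowski (Rep_hyp_plane p) (Rep_hyp_plane p)"
         "minkowski (Rep_hyp_plane p) q = minkowski (Rep_hyp_plane p) (Rep_hyp_plane p)"
      by (simp_all only: minkowski_boost[of q q v] minkowski_boost[of "Rep_hyp_plane p" q v]
          minkowski_boost[of "Rep_hyp_plane p" "Rep_hyp_plane p" v] boost height)
    then have "Rep_hyp_plane p = q"
      by (intro Rep_hyp_plane_eqI q3) simp_all
    then show "p \<in> geodesic_arc x y"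
      using ab by (auto simp: geodesic_arc_iff_cone q_def)
  }
qed

text \<open>The preimage \<open>q\<close> is the inverse boost applied to \<open>(X, Y, Z)\<close>,
  where \<open>Z\<close> is the required value of \<open>cosh (dist v p)\<close>.\<close>

lemma klein_surj:
  assumes "norm w < 1"
  shows "\<exists>p. klein v p = w"
proof -
  define a b c where "a = Rep_hyp_plane v $ 1" and "b = Rep_hyp_plane v $ 2"
    and "c = Rep_hyp_plane v $ 3"
  have c: "a\<^sup>2 + b\<^sup>2 = (c - 1) * (1 + c)" "1 + c \<noteq> 0" "c > 0"
    using minkowski_Rep_self[of v] Rep_hyp_plane_pos[of v]
    by (auto simp: minkowski_def a_def b_def c_def power2_eq_square algebra_simps)
  define Z where "Z = 1 / sqrt (1 - (norm w)\<^sup>2)"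
  define X Y where "X = Z * Re w" and "Y = Z * Im w"
  define s where "s = (a * X + b * Y) / (1 + c)"
  have s: "a * X + b * Y = s * (1 + c)"
    using c by (simp add: s_def)
  have w1: "1 - (norm w)\<^sup>2 > 0"
    using assms by (simp add: power_less_one_iff)
  have Z: "Z > 0" 
    using w1 by (simp add: Z_def)
  have "Z\<^sup>2 * (1 - (norm w)\<^sup>2) = 1"
    using w1 by (simp add: Z_def power_divide)
  then have ZXY: "Z\<^sup>2 = 1 + X\<^sup>2 + Y\<^sup>2"
    by (simp add: cmod_power2 X_def Y_def power_mult_distrib algebra_simps)
  define q :: "real^3" where "q = vector [X + a * (s + Z), Y + b * (s + Z), c * Z + s * (1 + c)]"
  have q: "q$1 = X + a * (s + Z)" "q$2 = Y + b * (s + Z)" "q$3 = c * Z + s * (1 + c)"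
    by (simp_all add: q_def)
  have mq: "minkowski q q = -1"
    unfolding minkowski_def q using s c(1) ZXY by algebra
  have mvq: "minkowski (Rep_hyp_plane v) q = - Z"
    unfolding minkowski_def q a_def[symmetric] b_def[symmetric] c_def[symmetric]
    using s c(1) by algebra
  \<comment> \<open>Cauchy-Schwarz puts \<open>q\<close> on the upper sheet:
    \<open>a * X + b * Y\<close> cannot outweigh \<open>c * Z\<close>.\<close>
  have "(s * (1 + c))\<^sup>2 \<le> (a\<^sup>2 + b\<^sup>2) * (X\<^sup>2 + Y\<^sup>2)"
  proof -
    have "(a\<^sup>2 + b\<^sup>2) * (X\<^sup>2 + Y\<^sup>2) - (s * (1 + c))\<^sup>2 = (a * Y - b * X)\<^sup>2"
      unfolding s[symmetric] by algebra
    then show ?thesis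
      by (metis diff_ge_0_iff_ge zero_le_power2)
  qed
  also have "\<dots> < (c * Z)\<^sup>2"
  proof -
    have "(c * Z)\<^sup>2 - (a\<^sup>2 + b\<^sup>2) * (X\<^sup>2 + Y\<^sup>2) = c\<^sup>2 + X\<^sup>2 + Y\<^sup>2"
      using c(1) ZXY by algebra
    moreover have "c\<^sup>2 + X\<^sup>2 + Y\<^sup>2 > 0"
      using c by (simp add: add_pos_nonneg)
    ultimately show ?thesis
      by linarith
  qed
  finally have "\<bar>s * (1 + c)\<bar>\<^sup>2 < (c * Z)\<^sup>2"
    by (simp only: power2_abs)
  then have "\<bar>s * (1 + c)\<bar> < c * Z"
    by (rule power2_less_imp_less) (simp add: c(3) Z less_imp_le)
  then have q3: "q $ 3 > 0"
    by (simp add: q)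
  define p where "p = Abs_hyp_plane q"
  have p: "Rep_hyp_plane p = q"
    unfolding p_def using mq q3 by (intro Abs_hyp_plane_inverse) simp
  have "(a * q$1 + b * q$2) / (1 + c) - q$3 = - (s + Z)"
  proof -
    have "a * q$1 + b * q$2 = (1 + c) * (q$3 - (s + Z))"
      unfolding q using s c(1) by algebra
    then show ?thesis
      using c by simp
  qed
  then have "boost v q = Complex (q$1 + a * - (s + Z)) (q$2 + b * - (s + Z))"
    unfolding boost_def Let_def a_def[symmetric] b_def[symmetric] c_def[symmetric] by (simp only:)
  also have "\<dots> = Z *\<^sub>R w"
    by (simp add: q X_def Y_def complex_eq_iff algebra_simps)
  finally have "klein v p = w"
    using Z by (simp add: klein_def p cosh_dist mvq)
  then show ?thesis ..
qed

lemma range_klein: "range (klein v) = ball 0 1"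
  using klein_surj norm_klein_less_1 by fastforce

definition klein_inv :: "complex \<Rightarrow> hyp_plane" where
  "klein_inv = inv (klein v)"

lemma klein_inv_klein [simp]: "klein_inv (klein v p) = p"
  by (simp add: klein_inv_def inj_klein)

lemma klein_klein_inv [simp]: "norm w < 1 \<Longrightarrow> klein v (klein_inv w) = w"
  using klein_surj[of w] by auto

text \<open>The topology of \<open>hyp_plane\<close> comes from \<open>dist\<close>, not from the
  embedding. So the Euclidean distance of boosted vectors is written through hyperbolic distances,
  in a form that vanishes as \<open>q\<close> tends to \<open>p\<close>.\<close>

lemma continuous_on_klein: "continuous_on UNIV (klein v)"
proof -
  have "continuous_on UNIV (\<lambda>p. boost v (Rep_hyp_plane p))"
    unfolding continuous_on
  proof
    fix p :: hyp_plane
    have eq: "norm (boost v (Rep_hyp_plane q) - boost v (Rep_hyp_plane p))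
        = sqrt (2 * (cosh (dist q p) - 1) + (cosh (dist v q) - cosh (dist v p))\<^sup>2)" for q
    proof -
      have "(norm (boost v (Rep_hyp_plane q) - boost v (Rep_hyp_plane p)))\<^sup>2
        = 2 * (cosh (dist q p) - 1) + (cosh (dist v q) - cosh (dist v p))\<^sup>2"
        using cosh_dist_klein[of q p] cosh_dist_klein[of q q] cosh_dist_klein[of p p]
        unfolding power2_norm_eq_inner
        by (simp add: boost_Rep algebra_simps inner_commute power2_eq_square)
      then show ?thesis
        by (metis norm_ge_zero real_sqrt_unique)
    qed
    have "((\<lambda>q. sqrt (2 * (cosh (dist q p) - 1) + (cosh (dist v q) - cosh (dist v p))\<^sup>2))
        \<longlongrightarrow> sqrt (2 * (cosh (dist p p) - 1) + (cosh (dist v p) - cosh (dist v p))\<^sup>2)) (at p)"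
      by (intro tendsto_intros)
    then have "((\<lambda>q. norm (boost v (Rep_hyp_plane q) - boost v (Rep_hyp_plane p))) \<longlongrightarrow> 0) (at p)"
      unfolding eq by simp
    then show "((\<lambda>q. boost v (Rep_hyp_plane q)) \<longlongrightarrow> boost v (Rep_hyp_plane p)) (at p)"
      by (subst tendsto_dist_iff) (simp only: dist_norm)
  qed
  then show ?thesis
    unfolding klein_def[abs_def] by (intro continuous_intros) simp_all
qed

lemma cosh_dist_klein_inv:
  assumes "norm w < 1"
  shows "cosh (dist v (klein_inv w)) = 1 / sqrt (1 - (norm w)\<^sup>2)"
proof -
  have "1 - (norm w)\<^sup>2 > 0"
    using assms by (simp add: power_less_one_iff)
  with cosh_dist_norm_klein[of "klein_inv w"] assms
  have "(cosh (dist v (klein_inv w)))\<^sup>2 = (1 / sqrt (1 - (norm w)\<^sup>2))\<^sup>2"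
    by (simp add: field_simps)
  then show ?thesis
    by (rule power2_eq_imp_eq) (use assms in \<open>simp_all add: power_le_one_iff\<close>)
qed

lemma continuous_on_klein_inv: "continuous_on (ball 0 1) klein_inv"
  unfolding continuous_on
proof
  fix w :: complex assume w: "w \<in> ball 0 1"
  define f where "f = (\<lambda>z. 1 / sqrt (1 - (norm z)\<^sup>2) * (1 / sqrt (1 - (norm w)\<^sup>2)) * (1 - z \<bullet> w))"
  have w1: "1 - (norm w)\<^sup>2 > 0"
    using w by (simp add: power_less_one_iff)
  have fw: "f w = 1"
    using w1 by (simp add: f_def power2_norm_eq_inner[symmetric])
  have cosh: "cosh (dist (klein_inv z) (klein_inv w)) = f z" if "z \<in> ball 0 1" for z
    using that w cosh_dist_klein[of "klein_inv z" "klein_inv w"]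
    by (simp add: cosh_dist_klein_inv f_def)
  have dist: "dist (klein_inv z) (klein_inv w) = arcosh (f z)" if "z \<in> ball 0 1" for z
    by (simp add: arcosh_cosh_real flip: cosh[OF that])
  have "(f \<longlongrightarrow> f w) (at w within ball 0 1)"
    unfolding f_def by (intro tendsto_intros) (use w1 in auto)
  then have "(f \<longlongrightarrow> 1) (at w within ball 0 1)"
    unfolding fw .
  \<comment> \<open>The limit \<open>1\<close> is the left end of the domain of
    \<open>arcosh\<close>, so \<open>f\<close> must be known to stay at or above it.\<close>
  moreover have "eventually (\<lambda>z. f z \<ge> 1) (at w within ball 0 1)"
    unfolding eventually_at_topological using cosh by (metis cosh_real_ge_1 open_UNIV UNIV_I)
  ultimately have "((\<lambda>z. arcosh (f z)) \<longlongrightarrow> arcosh 1) (at w within ball 0 1)"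
    by (intro tendsto_arcosh_strong) auto
  then have "((\<lambda>z. dist (klein_inv z) (klein_inv w)) \<longlongrightarrow> 0) (at w within ball 0 1)"
    by (subst tendsto_cong[where g = "\<lambda>z. arcosh (f z)"])
      (auto simp: eventually_at_filter dist)
  then show "(klein_inv \<longlongrightarrow> klein_inv w) (at w within ball 0 1)"
    by (subst tendsto_dist_iff)
qed

end

section \<open>Transfer of convexity, hulls and topology to the disc\<close>

context
  fixes v :: hyp_plane
begin

lemma klein_image_subset_ball: "klein v ` A \<subseteq> ball 0 1"
  using range_klein by blast

lemma hyp_convex_iff_klein: "hyp_convex C \<longleftrightarrow> convex (klein v ` C)"
proof
  assume C: "hyp_convex C"
  show "convex (klein v ` C)"
    unfolding convex_contains_segment
  proof (intro ballI subsetI)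
    fix a b w assume "a \<in> klein v ` C" "b \<in> klein v ` C" and w: "w \<in> closed_segment a b"
    then obtain x y where xy: "x \<in> C" "y \<in> C" "a = klein v x" "b = klein v y"
      by blast
    have "closed_segment a b \<subseteq> ball 0 1"
      using xy klein_image_subset_ball[of C] by (intro closed_segment_subset convex_ball) blast+
    with w range_klein[of v] obtain p where "w = klein v p"
      by blast
    with w C xy show "w \<in> klein v ` C"
      by (auto simp: hyp_convex_def simp flip: klein_geodesic_arc_iff)
  qed
next
  assume C: "convex (klein v ` C)"
  show "hyp_convex C"
    unfolding hyp_convex_def
  proof (intro ballI subsetI)
    fix x y p assume "x \<in> C" "y \<in> C" "p \<in> geodesic_arc x y"
    then have "klein v p \<in> klein v ` C"
      using C closed_segment_subset[of "klein v x" "klein v ` C" "klein v y"]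
      by (auto simp: klein_geodesic_arc_iff[of _ _ _ v])
    then show "p \<in> C"
      by auto
  qed
qed

text \<open>Minimality of the hull on both sides. The preimage of the Euclidean hull is
  hyperbolically convex because that hull stays in the unit ball, the range of the
  projection.\<close>

lemma klein_hyp_convex_hull: "klein v ` (hyp_convex_hull A) = convex hull (klein v ` A)"
proof
  have ball: "convex hull (klein v ` A) \<subseteq> ball 0 1"
    using klein_image_subset_ball by (intro hull_minimal) auto
  have "klein v ` {p. klein v p \<in> convex hull (klein v ` A)} = convex hull (klein v ` A)"
    using ball unfolding range_klein[of v, symmetric] by blast
  then have "hyp_convex {p. klein v p \<in> convex hull (klein v ` A)}"
    unfolding hyp_convex_iff_klein by simp
  then have "hyp_convex_hull A \<subseteq> {p. klein v p \<in> convex hull (klein v ` A)}"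
    by (intro hull_minimal) (auto intro: hull_inc)
  then show "klein v ` (hyp_convex_hull A) \<subseteq> convex hull (klein v ` A)"
    by blast
  have "hyp_convex (hyp_convex_hull A)"
    by (rule hull_in) (unfold hyp_convex_def, blast)
  then show "convex hull (klein v ` A) \<subseteq> klein v ` (hyp_convex_hull A)"
    unfolding hyp_convex_iff_klein by (intro hull_minimal image_mono hull_subset)
qed

lemma extreme_points_iff_klein:
  "p \<in> extreme_points C \<longleftrightarrow> klein v p extreme_point_of klein v ` C"
  by (auto simp: extreme_points_def extreme_point_of_def open_segment_def klein_geodesic_arc_iff[of _ _ _ v]
      image_iff)

lemma open_klein_image:
  assumes "open U"
  shows "open (klein v ` U)"
proof -
  have "homeomorphism UNIV (ball 0 1) (klein v) (klein_inv v)"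
  proof (rule homeomorphismI)
    show "klein_inv v ` ball 0 1 \<subseteq> UNIV" "klein v ` UNIV \<subseteq> ball 0 1"
      by (simp_all add: range_klein)
  qed (use continuous_on_klein continuous_on_klein_inv in auto)
  then have "openin (top_of_set (ball 0 1)) (klein v ` U)"
    by (rule homeomorphism_imp_open_map) (use assms in simp)
  then show ?thesis
    using openin_open_trans by blast
qed

lemma interior_klein_image: "interior (klein v ` P) = klein v ` interior P"
proof
  show "klein v ` interior P \<subseteq> interior (klein v ` P)"
    by (intro interior_maximal image_mono interior_subset open_klein_image open_interior)
  have "open (klein v -` interior (klein v ` P))"
    by (intro open_vimage open_interior continuous_on_klein)
  moreover have "klein v -` interior (klein v ` P) \<subseteq> P"
    using interior_subset[of "klein v ` P"] by auto
  ultimately have "klein v -` interior (klein v ` P) \<subseteq> interior P"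
    by (rule interior_maximal[rotated])
  moreover have "interior (klein v ` P) \<subseteq> range (klein v)"
    using interior_subset[of "klein v ` P"] by auto
  ultimately show "interior (klein v ` P) \<subseteq> klein v ` interior P"
    by blast
qed

text \<open>The ball lies in the image of a Euclidean disc of radius less than \<open>1\<close>,
  which is compact. An infinite part of \<open>S\<close> in it would have a limit point, which
  closedness puts in \<open>S\<close> and discreteness forbids.\<close>

lemma finite_Int_cball:
  assumes "closed S" "discrete S"
  shows "finite (S \<inter> cball v R)"
proof -
  \<comment> \<open>This is \<open>\<bar>tanh R\<bar>\<close>.\<close>
  define \<rho> where "\<rho> = sqrt (1 - 1 / (cosh R)\<^sup>2)"
  have c: "(cosh R)\<^sup>2 \<ge> 1"
    by (simp add: cosh_real_ge_1)
  have \<rho>: "\<rho> < 1" "\<rho>\<^sup>2 = 1 - 1 / (cosh R)\<^sup>2"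
    using c by (simp_all add: \<rho>_def)
  have "cball v R \<subseteq> klein_inv v ` cball 0 \<rho>"
  proof
    fix p assume p: "p \<in> cball v R"
    have "cosh (dist v p) \<le> cosh R"
      using p by (subst cosh_real_nonneg_le_iff) (auto intro: order_trans[OF zero_le_dist])
    then have le: "(cosh (dist v p))\<^sup>2 \<le> (cosh R)\<^sup>2"
      by (intro power_mono) auto
    have "(norm (klein v p))\<^sup>2 = 1 - 1 / (cosh (dist v p))\<^sup>2"
      using cosh_dist_norm_klein[of v p] by (simp add: field_simps)
    also have "\<dots> \<le> \<rho>\<^sup>2"
      unfolding \<rho>(2) using le by (intro diff_left_mono divide_left_mono) auto
    finally have "norm (klein v p) \<le> \<rho>"
      by (rule power2_le_imp_le) (use c in \<open>simp add: \<rho>_def\<close>)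
    then have "klein v p \<in> cball 0 \<rho>"
      by simp
    then show "p \<in> klein_inv v ` cball 0 \<rho>"
      by (metis imageI klein_inv_klein)
  qed
  moreover have "compact (klein_inv v ` cball 0 \<rho>)"
    using \<rho> by (intro compact_continuous_image continuous_on_subset[OF continuous_on_klein_inv]) auto
  moreover have "finite (S \<inter> K)" if K: "compact K" for K
  proof (rule ccontr)
    assume inf: "infinite (S \<inter> K)"
    then obtain x where x: "x islimpt (S \<inter> K)"
      using Heine_Borel_imp_Bolzano_Weierstrass[OF K inf] by auto
    then have "x islimpt S"
      by (rule islimpt_subset) simp
    with assms show False
      by (auto simp: closed_limpt discrete_def isolated_in_islimpt_iff)
  qed
  ultimately show ?thesis
    by (meson finite_subset inf_mono order_refl)
qed

end

section \<open>Chords of a circle\<close>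

lemma inner_frame:
  fixes n a b :: complex
  assumes "norm n = 1"
  shows "a \<bullet> b = (n \<bullet> a) * (n \<bullet> b) + ((\<i> * n) \<bullet> a) * ((\<i> * n) \<bullet> b)"
proof -
  have "(Re n)\<^sup>2 + (Im n)\<^sup>2 = 1"
    using assms by (simp flip: cmod_power2)
  then show ?thesis
    unfolding inner_complex_def by simp algebra
qed

lemma inner_frame_self:
  fixes n a :: complex
  assumes "norm n = 1"
  shows "((\<i> * n) \<bullet> a)\<^sup>2 = (norm a)\<^sup>2 - (n \<bullet> a)\<^sup>2"
  using inner_frame[OF assms, of a a] power2_norm_eq_inner[of a] unfolding power2_eq_square by linarith

lemma frame_eqI:
  fixes n a b :: complex
  assumes "norm n = 1" "n \<bullet> a = n \<bullet> b" "(\<i> * n) \<bullet> a = (\<i> * n) \<bullet> b"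
  shows "a = b"
proof -
  have "(a - b) \<bullet> (a - b) = 0"
    unfolding inner_frame[OF assms(1), of "a - b" "a - b"] using assms by (simp add: inner_diff_right)
  then show ?thesis
    by simp
qed

text \<open>A side of the polygon, encoded by outer unit normal and signed height instead of by
  neighbours in a cyclic order. For \<open>h < 0\<close> the line separates \<open>B\<close> from
  \<open>0\<close>; for \<open>h = 0\<close> it passes through \<open>0\<close>.\<close>

definition supporting_chord :: "complex set \<Rightarrow> complex \<Rightarrow> complex \<Rightarrow> complex \<Rightarrow> real \<Rightarrow> bool" where
  "supporting_chord B u w n h \<longleftrightarrow> u \<in> B \<and> w \<in> B \<and> u \<noteq> w \<and> norm n = 1 \<and> n \<bullet> u = h \<and> n \<bullet> w = h \<and>
     (\<forall>a\<in>B. n \<bullet> a \<le> h)"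

text \<open>At equal norm and equal height the coordinates along the line agree up to sign. So the
  midpoint of the chord is the foot of the perpendicular from \<open>0\<close>.\<close>

lemma chord_coords:
  fixes n u w :: complex
  assumes "norm n = 1" "norm u = r" "norm w = r" "u \<noteq> w" "n \<bullet> u = h" "n \<bullet> w = h"
  shows "(\<i> * n) \<bullet> w = - ((\<i> * n) \<bullet> u)" "(\<i> * n) \<bullet> u \<noteq> 0" "((\<i> * n) \<bullet> u)\<^sup>2 = r\<^sup>2 - h\<^sup>2"
    and "(1/2) *\<^sub>R u + (1/2) *\<^sub>R w = h *\<^sub>R n"
proof -
  have u: "((\<i> * n) \<bullet> u)\<^sup>2 = r\<^sup>2 - h\<^sup>2" and w: "((\<i> * n) \<bullet> w)\<^sup>2 = r\<^sup>2 - h\<^sup>2"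
    using inner_frame_self[OF assms(1), of u] inner_frame_self[OF assms(1), of w] assms
    by simp_all
  have ne: "(\<i> * n) \<bullet> u \<noteq> (\<i> * n) \<bullet> w"
    using frame_eqI[OF assms(1), of u w] assms by auto
  from u w have "((\<i> * n) \<bullet> u)\<^sup>2 = ((\<i> * n) \<bullet> w)\<^sup>2"
    by simp
  with ne show eq: "(\<i> * n) \<bullet> w = - ((\<i> * n) \<bullet> u)"
    by (auto simp: power2_eq_iff)
  with ne show "(\<i> * n) \<bullet> u \<noteq> 0"
    by auto
  show "((\<i> * n) \<bullet> u)\<^sup>2 = r\<^sup>2 - h\<^sup>2"
    by (rule u)
  have "n \<bullet> n = 1" "(\<i> * n) \<bullet> n = 0"
    using assms(1) by (simp_all flip: power2_norm_eq_inner add: inner_complex_def)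
  then show "(1/2) *\<^sub>R u + (1/2) *\<^sub>R w = h *\<^sub>R n"
    using eq assms by (intro frame_eqI[OF assms(1)]) (simp_all add: inner_add_right)
qed

lemma chord_endpoints:
  fixes n u w a :: complex
  assumes "norm n = 1" "norm u = r" "norm w = r" "u \<noteq> w" "n \<bullet> u = h" "n \<bullet> w = h"
    and "norm a = r" "n \<bullet> a = h"
  shows "a = u \<or> a = w"
  using chord_coords(1)[OF assms(1-6)] chord_coords(1)[OF assms(1,2,7) _ assms(5,8)]
    frame_eqI[OF assms(1), of a w] assms by fastforce

text \<open>On a circle a smaller inner product means a longer chord. Heights at most
  \<open>h \<le> 0\<close> have a product of at least \<open>h\<^sup>2\<close>; the positions along
  the chord are at most \<open>\<bar>\<sigma>\<bar>\<close> in size, so theirs is at least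
  \<open>- \<sigma>\<^sup>2\<close>. Equality in both forces \<open>{a, b} = {u, w}\<close>.\<close>

lemma longest_chord:
  assumes "supporting_chord B u w n h" "B \<subseteq> sphere 0 r" "h \<le> 0"
    and "a \<in> B" "b \<in> B" "{a, b} \<noteq> {u, w}"
  shows "u \<bullet> w < a \<bullet> b"
proof -
  have n: "norm n = 1" and uw: "norm u = r" "norm w = r" "u \<noteq> w" "n \<bullet> u = h" "n \<bullet> w = h"
    and ab: "norm a = r" "norm b = r" "n \<bullet> a \<le> h" "n \<bullet> b \<le> h"
    using assms by (auto simp: supporting_chord_def)
  define s t \<sigma> where "s = (\<i> * n) \<bullet> a" and "t = (\<i> * n) \<bullet> b" and "\<sigma> = (\<i> * n) \<bullet> u"
  note cc = chord_coords[OF n uw]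
  have st: "s\<^sup>2 = r\<^sup>2 - (n \<bullet> a)\<^sup>2" "t\<^sup>2 = r\<^sup>2 - (n \<bullet> b)\<^sup>2"
    using inner_frame_self[OF n, of a] inner_frame_self[OF n, of b] ab
    by (simp_all add: s_def t_def)
  have sq: "(n \<bullet> a)\<^sup>2 \<ge> h\<^sup>2" "(n \<bullet> b)\<^sup>2 \<ge> h\<^sup>2"
    using ab assms(3) by (simp_all flip: abs_le_square_iff)
  have \<sigma>: "\<sigma>\<^sup>2 = r\<^sup>2 - h\<^sup>2"
    using cc(3) by (simp add: \<sigma>_def)
  have uwv: "u \<bullet> w = h\<^sup>2 - \<sigma>\<^sup>2"
    using inner_frame[OF n, of u w] uw cc(1) by (simp add: \<sigma>_def power2_eq_square)
  have abv: "a \<bullet> b = (n \<bullet> a) * (n \<bullet> b) + s * t"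
    using inner_frame[OF n, of a b] by (simp add: s_def t_def)
  have prod: "(n \<bullet> a) * (n \<bullet> b) \<ge> h\<^sup>2"
    using mult_mono[of "- h" "- (n \<bullet> a)" "- h" "- (n \<bullet> b)"] ab assms(3)
    by (simp add: power2_eq_square)
  have "0 \<le> (s + t)\<^sup>2"
    by simp
  then have st0: "- 2 * (s * t) \<le> s\<^sup>2 + t\<^sup>2"
    using power2_sum[of s t] by linarith
  show ?thesis
  proof (rule ccontr)
    assume "\<not> ?thesis"
    then have le: "s * t \<le> - \<sigma>\<^sup>2"
      using uwv abv prod by simp
    then have "s\<^sup>2 = \<sigma>\<^sup>2" "t\<^sup>2 = \<sigma>\<^sup>2" and "(s + t)\<^sup>2 = 0"
      using st0 st sq \<sigma> power2_sum[of s t] by linarith+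
    then have "(n \<bullet> a)\<^sup>2 = h\<^sup>2" "(n \<bullet> b)\<^sup>2 = h\<^sup>2" and neg: "s = - t"
      using st \<sigma> by (simp_all add: add_eq_0_iff)
    then have eq: "n \<bullet> a = h" "n \<bullet> b = h"
      using ab assms(3) by (auto simp: power2_eq_iff)
    have "a = u \<or> a = w" "b = u \<or> b = w"
      using chord_endpoints[OF n uw] ab eq by blast+
    moreover have "a \<noteq> b"
      using neg \<open>s\<^sup>2 = \<sigma>\<^sup>2\<close> cc(2) by (auto simp: s_def t_def \<sigma>_def)
    ultimately show False
      using assms(6) by (elim disjE) (simp_all add: insert_commute)
  qed
qed

text \<open>The sides are \<open>2 * cos m * cos m\<close> and \<open>2 * cos m * cos d\<close> for
  the half sum \<open>m\<close> and half difference \<open>d\<close>, where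
  \<open>\<bar>d\<bar> \<le> m \<le> pi / 2\<close>.\<close>

lemma cos_add_cos_ge:
  fixes x y :: real
  assumes "x \<ge> 0" "y \<ge> 0" "x + y \<le> pi"
  shows "1 + cos (x + y) \<le> cos x + cos y"
proof -
  define m d where "m = (x + y) / 2" and "d = (x - y) / 2"
  have "cos m \<ge> 0"
    using assms by (intro cos_ge_zero) (auto simp: m_def)
  moreover have "cos m \<le> cos \<bar>d\<bar>"
    using assms by (intro cos_monotone_0_pi_le) (auto simp: m_def d_def)
  ultimately have "2 * (cos m * cos m) \<le> 2 * (cos m * cos d)"
    by (intro mult_left_mono) auto
  moreover have "cos x + cos y = 2 * (cos m * cos d)"
    by (simp add: cos_plus_cos m_def d_def)
  moreover have "x + y = 2 * m"
    by (simp add: m_def)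
  then have "cos (x + y) = 2 * (cos m * cos m) - 1"
    by (simp only: cos_double_cos power2_eq_square)
  ultimately show ?thesis
    by linarith
qed

text \<open>Thales for arcs up to a half circle: \<open>a\<close> lies on the arc from
  \<open>u\<close> to \<open>w\<close>, so it sees the chord under an angle that is not acute. In
  polar angles this is \<open>cos_add_cos_ge\<close>, scaled by \<open>r\<^sup>2\<close>.\<close>

lemma inscribed_angle_obtuse:
  fixes n u w a :: complex
  assumes n: "norm n = 1"
    and r: "norm u = r" "norm w = r" "norm a = r"
    and half: "n \<bullet> u \<le> 0" "n \<bullet> w \<le> 0" "n \<bullet> a \<le> 0"
    and between: "(\<i> * n) \<bullet> w \<le> (\<i> * n) \<bullet> a" "(\<i> * n) \<bullet> a \<le> (\<i> * n) \<bullet> u"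
  shows "(u - a) \<bullet> (w - a) \<le> 0"
proof (cases "r = 0")
  case True
  with r show ?thesis
    by simp
next
  case False
  then have r0: "r > 0"
    using r(1) norm_ge_zero[of u] by linarith
  \<comment> \<open>The angle from \<open>\<i> * n\<close>, measured away from \<open>n\<close>; the
    half circle \<open>n \<bullet> z \<le> 0\<close> has angles in \<open>{0..pi}\<close>.\<close>
  define \<theta> where "\<theta> = (\<lambda>z. arccos (((\<i> * n) \<bullet> z) / r))"
  have polar: "0 \<le> \<theta> z \<and> \<theta> z \<le> pi \<and> (\<i> * n) \<bullet> z = r * cos (\<theta> z) \<and> n \<bullet> z = - r * sin (\<theta> z)"
    if z: "norm z = r" "n \<bullet> z \<le> 0" for z
  proof -
    have sq: "((\<i> * n) \<bullet> z)\<^sup>2 = r\<^sup>2 - (n \<bullet> z)\<^sup>2"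
      using inner_frame_self[OF n, of z] z by simp
    then have "((\<i> * n) \<bullet> z)\<^sup>2 \<le> r\<^sup>2"
      using zero_le_power2[of "n \<bullet> z"] by linarith
    then have "\<bar>(\<i> * n) \<bullet> z\<bar> \<le> r"
      using r0 abs_le_square_iff[of "(\<i> * n) \<bullet> z" r] by linarith
    then have b: "- 1 \<le> ((\<i> * n) \<bullet> z) / r" "((\<i> * n) \<bullet> z) / r \<le> 1"
      using r0 by (auto simp: field_simps)
    have "(- (n \<bullet> z) / r)\<^sup>2 = 1 - (((\<i> * n) \<bullet> z) / r)\<^sup>2"
      using r0 sq by (simp add: field_simps)
    then have "sqrt (1 - (((\<i> * n) \<bullet> z) / r)\<^sup>2) = - (n \<bullet> z) / r"
      using r0 z(2) by (intro real_sqrt_unique) (auto simp: divide_nonpos_pos)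
    then have "sin (\<theta> z) = - (n \<bullet> z) / r"
      using b by (simp add: \<theta>_def sin_arccos)
    then show ?thesis
      using b r0 by (simp add: \<theta>_def arccos_lbound arccos_ubound)
  qed
  have inner: "y \<bullet> z = r\<^sup>2 * cos (\<theta> z - \<theta> y)"
    if "norm y = r" "n \<bullet> y \<le> 0" "norm z = r" "n \<bullet> z \<le> 0" for y z
    unfolding inner_frame[OF n, of y z] using polar[of y] polar[of z] that
    by (simp add: cos_diff power2_eq_square algebra_simps)
  have le: "\<theta> u \<le> \<theta> a" "\<theta> a \<le> \<theta> w"
    using cos_mono_le_eq[of "\<theta> a" "\<theta> u"] cos_mono_le_eq[of "\<theta> w" "\<theta> a"]
      polar[of u] polar[of w] polar[of a] r half between r0
    by simp_all
  have "1 + cos ((\<theta> a - \<theta> u) + (\<theta> w - \<theta> a)) \<le> cos (\<theta> a - \<theta> u) + cos (\<theta> w - \<theta> a)"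
    using le polar[of u] polar[of w] r half by (intro cos_add_cos_ge) auto
  then have "r\<^sup>2 * (1 + cos (\<theta> w - \<theta> u)) \<le> r\<^sup>2 * (cos (\<theta> a - \<theta> u) + cos (\<theta> w - \<theta> a))"
    by (intro mult_left_mono) auto
  moreover have "(u - a) \<bullet> (w - a) = u \<bullet> w - u \<bullet> a - a \<bullet> w + a \<bullet> a"
    by (simp add: inner_diff inner_commute)
  ultimately show ?thesis
    using inner[of u w] inner[of u a] inner[of a w] inner[of a a] r half
    by (simp add: algebra_simps)
qed

text \<open>The points of \<open>B\<close> extreme along the bounding line of the half plane span a
  side: for \<open>u + w \<noteq> 0\<close>, the angle condition at \<open>a\<close> reads
  \<open>r\<^sup>2 + u \<bullet> w \<le> (u + w) \<bullet> a\<close>, which puts \<open>a\<close> on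
  or beyond the line through \<open>u\<close> and \<open>w\<close> as seen from
  \<open>0\<close>.\<close>

lemma supporting_chord_exists:
  fixes B :: "complex set"
  assumes "finite B" "B \<subseteq> sphere 0 r" "x \<in> B" "y \<in> B" "x \<noteq> y"
    and n: "norm n = 1" and half: "\<And>a. a \<in> B \<Longrightarrow> n \<bullet> a \<le> 0"
  shows "\<exists>u w n' h. supporting_chord B u w n' h \<and> h \<le> 0"
proof -
  have norm: "norm a = r" if "a \<in> B" for a
    using that assms(2) by auto
  define u where "u = arg_min_on (\<lambda>a. - ((\<i> * n) \<bullet> a)) B"
  define w where "w = arg_min_on (\<lambda>a. (\<i> * n) \<bullet> a) B"
  have u: "u \<in> B" "\<And>a. a \<in> B \<Longrightarrow> (\<i> * n) \<bullet> a \<le> (\<i> * n) \<bullet> u"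
    using arg_min_if_finite(1)[OF assms(1), of "\<lambda>a. - ((\<i> * n) \<bullet> a)"]
      arg_min_least[OF assms(1), of _ "\<lambda>a. - ((\<i> * n) \<bullet> a)"] assms(3)
    unfolding u_def by auto
  have w: "w \<in> B" "\<And>a. a \<in> B \<Longrightarrow> (\<i> * n) \<bullet> w \<le> (\<i> * n) \<bullet> a"
    using arg_min_if_finite(1)[OF assms(1), of "\<lambda>a. (\<i> * n) \<bullet> a"]
      arg_min_least[OF assms(1), of _ "\<lambda>a. (\<i> * n) \<bullet> a"] assms(3)
    unfolding w_def by auto
  have obtuse: "(u - a) \<bullet> (w - a) \<le> 0" if "a \<in> B" for a
    using that u w norm half by (intro inscribed_angle_obtuse[OF n]) auto
  have ne: "u \<noteq> w"
  proof
    assume "u = w"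
    then have "a = u" if "a \<in> B" for a
      using obtuse[OF that] inner_gt_zero_iff[of "u - a"] \<open>u = w\<close> by fastforce
    then show False
      using assms by blast
  qed
  show ?thesis
  proof (cases "u + w = 0")
    \<comment> \<open>Here \<open>u + w\<close> gives no normal direction, but the chord is a
      diameter on the given line, so \<open>n\<close> itself serves.\<close>
    case True
    then have "u = - w"
      by (simp add: add_eq_0_iff)
    then have "n \<bullet> u = - (n \<bullet> w)"
      by simp
    with half[OF u(1)] half[OF w(1)] have "n \<bullet> u = 0" "n \<bullet> w = 0"
      by simp_all
    then have "supporting_chord B u w n 0"
      using u w ne n half by (simp add: supporting_chord_def)
    then show ?thesis
      by blast
  next
    case False
    define m where "m = norm (u + w)"
    \<comment> \<open>Since \<open>u\<close> and \<open>w\<close> have the same norm,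
      \<open>u + w\<close> is perpendicular to the chord; the sign makes \<open>n'\<close> point
      from the chord back towards \<open>0\<close>.\<close>
    define n' where "n' = (- 1 / m) *\<^sub>R (u + w)"
    define h where "h = - (r\<^sup>2 + u \<bullet> w) / m"
    have m: "m > 0"
      using False by (simp add: m_def)
    have n': "n' \<bullet> a = - ((u + w) \<bullet> a) / m" for a
      unfolding n'_def inner_scaleR_left by simp
    have rr: "a \<bullet> a = r\<^sup>2" if "a \<in> B" for a
      using norm[OF that] by (simp add: dot_square_norm)
    have "n' \<bullet> a \<le> h" if "a \<in> B" for a
    proof -
      have "r\<^sup>2 + u \<bullet> w \<le> (u + w) \<bullet> a"
        using obtuse[OF that] rr[OF that] by (simp add: inner_diff inner_add inner_commute)
      then show ?thesis
        using m unfolding n' h_def by (intro divide_right_mono) simp_all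
    qed
    moreover have "n' \<bullet> u = h" "n' \<bullet> w = h"
      using rr[OF u(1)] rr[OF w(1)]
      by (simp_all add: n' h_def inner_add inner_commute)
    moreover have "norm n' = 1"
      using m by (simp add: n'_def flip: m_def)
    ultimately have "supporting_chord B u w n' h"
      using u w ne by (simp add: supporting_chord_def)
    moreover have "- (u \<bullet> w) \<le> r\<^sup>2"
      using Cauchy_Schwarz_ineq2[of u w] norm[OF u(1)] norm[OF w(1)] by (simp add: power2_eq_square)
    then have "h \<le> 0"
      using m by (simp add: h_def field_simps)
    ultimately show ?thesis
      by blast
  qed
qed

text \<open>If \<open>h = 0\<close>, then \<open>0\<close> lies on the chord already. Otherwise a
  segment from \<open>0\<close> to a point of \<open>convex hull B\<close> crosses the chord: up to
  the crossing it runs in the triangle, beyond it in \<open>convex hull B\<close>.\<close>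

lemma convex_hull_Un_triangle:
  assumes chord: "supporting_chord B u w n h" and B: "B \<subseteq> sphere 0 r" and h: "h \<le> 0"
  shows "convex hull B \<union> convex hull {0, u, w} = convex hull (insert 0 B)"
proof
  have n: "norm n = 1" and uw: "norm u = r" "norm w = r" "u \<noteq> w" "n \<bullet> u = h" "n \<bullet> w = h"
    and uwB: "u \<in> B" "w \<in> B"
    using assms by (auto simp: supporting_chord_def)
  note cc = chord_coords[OF n uw]
  have seg: "closed_segment u w \<subseteq> convex hull B"
    using uwB by (intro closed_segment_subset hull_inc convex_convex_hull)
  show "convex hull B \<union> convex hull {0, u, w} \<subseteq> convex hull (insert 0 B)"
    using uwB by (intro Un_least hull_mono) auto
  show "convex hull (insert 0 B) \<subseteq> convex hull B \<union> convex hull {0, u, w}"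
  proof (cases "h = 0")
    case True
    then have "0 \<in> closed_segment u w"
      using cc(4) unfolding closed_segment_def by (auto intro!: exI[of _ "1/2"])
    with seg have "0 \<in> convex hull B"
      by blast
    then show ?thesis
      by (simp add: hull_redundant)
  next
    case False
    with h have h0: "h < 0"
      by simp
    \<comment> \<open>The part of the cone over the chord that lies on or beyond it. It contains
      \<open>B\<close> because for \<open>h < 0\<close> no point of the arc is farther out sideways
      than the endpoints of the chord.\<close>
    define K where "K = {z. \<exists>\<alpha> \<beta>. z = \<alpha> *\<^sub>R u + \<beta> *\<^sub>R w \<and> \<alpha> \<ge> 0 \<and> \<beta> \<ge> 0 \<and> \<alpha> + \<beta> \<ge> 1}"
    have "convex K"
    proof (rule convexI)
      fix x y :: complex and s t :: real
      assume "x \<in> K" "y \<in> K" and st: "0 \<le> s" "0 \<le> t" "s + t = 1"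
      then obtain a b c d where x: "x = a *\<^sub>R u + b *\<^sub>R w" "a \<ge> 0" "b \<ge> 0" "a + b \<ge> 1"
        and y: "y = c *\<^sub>R u + d *\<^sub>R w" "c \<ge> 0" "d \<ge> 0" "c + d \<ge> 1"
        by (auto simp: K_def)
      have "s * (a + b) + t * (c + d) \<ge> s * 1 + t * 1"
        using x y st by (intro add_mono mult_left_mono)
      then have "(s * a + t * c) + (s * b + t * d) \<ge> 1"
        using st by (simp add: algebra_simps)
      moreover have "s *\<^sub>R x + t *\<^sub>R y = (s * a + t * c) *\<^sub>R u + (s * b + t * d) *\<^sub>R w"
        by (simp add: x y algebra_simps)
      ultimately show "s *\<^sub>R x + t *\<^sub>R y \<in> K"
        unfolding K_def mem_Collect_eq using x y st by (metis add_nonneg_nonneg mult_nonneg_nonneg)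
    qed
    moreover have "B \<subseteq> K"
    proof
      fix a assume a: "a \<in> B"
      define \<sigma> s c where "\<sigma> = (\<i> * n) \<bullet> u" and "s = (\<i> * n) \<bullet> a" and "c = (n \<bullet> a) / h"
      have na: "norm a = r" "n \<bullet> a \<le> h"
        using a B chord by (auto simp: supporting_chord_def)
      have c1: "c \<ge> 1"
        using na h0 by (simp add: c_def field_simps)
      have "s\<^sup>2 = r\<^sup>2 - (n \<bullet> a)\<^sup>2"
        using inner_frame_self[OF n, of a] na by (simp add: s_def)
      moreover have "h\<^sup>2 \<le> (n \<bullet> a)\<^sup>2"
        using na h by (simp flip: abs_le_square_iff)
      ultimately have "s\<^sup>2 \<le> \<sigma>\<^sup>2"
        using cc(3) by (simp add: \<sigma>_def)
      then have "\<bar>s\<bar> \<le> \<bar>\<sigma>\<bar>"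
        by (simp add: abs_le_square_iff)
      then have "\<bar>s / \<sigma>\<bar> \<le> 1"
        using cc(2) by (simp add: \<sigma>_def abs_divide)
      then have "(c + s / \<sigma>) / 2 \<ge> 0" "(c - s / \<sigma>) / 2 \<ge> 0" "(c + s / \<sigma>) / 2 + (c - s / \<sigma>) / 2 \<ge> 1"
        using c1 unfolding abs_le_iff by (simp_all add: add_divide_distrib diff_divide_distrib)
      moreover have "a = ((c + s / \<sigma>) / 2) *\<^sub>R u + ((c - s / \<sigma>) / 2) *\<^sub>R w"
      proof (rule frame_eqI[OF n])
        have "(c + s / \<sigma>) / 2 * h + (c - s / \<sigma>) / 2 * h = c * h"
          by (simp add: field_simps)
        then show "n \<bullet> a = n \<bullet> (((c + s / \<sigma>) / 2) *\<^sub>R u + ((c - s / \<sigma>) / 2) *\<^sub>R w)"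
          using h0 by (simp add: inner_add_right uw c_def)
        have "(c + s / \<sigma>) / 2 * \<sigma> + (c - s / \<sigma>) / 2 * - \<sigma> = s / \<sigma> * \<sigma>"
          by (simp add: algebra_simps add_divide_distrib diff_divide_distrib)
        also have "\<dots> = s"
          using cc(2) by (simp add: \<sigma>_def)
        finally show "(\<i> * n) \<bullet> a = (\<i> * n) \<bullet> (((c + s / \<sigma>) / 2) *\<^sub>R u + ((c - s / \<sigma>) / 2) *\<^sub>R w)"
          by (simp add: inner_add_right cc(1) s_def \<sigma>_def)
      qed
      ultimately show "a \<in> K"
        unfolding K_def by blast
    qed
    ultimately have sub: "convex hull B \<subseteq> K"
      by (rule hull_minimal[rotated])
    show ?thesis
    proof
      fix z assume "z \<in> convex hull (insert 0 B)"
      then obtain q where q: "q \<in> convex hull B" "z \<in> closed_segment 0 q"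
        using uwB by (auto simp: convex_hull_insert_segments split: if_splits)
      then obtain t where t: "0 \<le> t" "t \<le> 1" "z = t *\<^sub>R q"
        by (auto simp: in_segment)
      obtain \<alpha> \<beta> where ab: "q = \<alpha> *\<^sub>R u + \<beta> *\<^sub>R w" "\<alpha> \<ge> 0" "\<beta> \<ge> 0" "\<alpha> + \<beta> \<ge> 1"
        using q(1) sub by (auto simp: K_def)
      define c where "c = \<alpha> + \<beta>"
      show "z \<in> convex hull B \<union> convex hull {0, u, w}"
      proof (cases "t * c \<le> 1")
        case True
        have "z = (1 - t * c) *\<^sub>R 0 + (t * \<alpha>) *\<^sub>R u + (t * \<beta>) *\<^sub>R w"
          by (simp add: t ab scaleR_add_right)
        moreover have "(1 - t * c) + t * \<alpha> + t * \<beta> = 1"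
          by (simp add: c_def algebra_simps)
        ultimately have "z \<in> convex hull {0, u, w}"
          unfolding convex_hull_3 mem_Collect_eq using True t ab
          by (metis diff_ge_0_iff_ge mult_nonneg_nonneg)
        then show ?thesis ..
      next
        case False
        define q' where "q' = (1 / c) *\<^sub>R q"
        have c: "c > 1"
          using False t by (smt (verit) ab(4) c_def mult_left_le_one_le)
        have "q' = (\<alpha> / c) *\<^sub>R u + (\<beta> / c) *\<^sub>R w"
          by (simp add: q'_def ab scaleR_add_right)
        moreover have "\<alpha> / c + \<beta> / c = 1"
          using c by (simp add: c_def flip: add_divide_distrib)
        moreover have "\<alpha> / c \<ge> 0" "\<beta> / c \<ge> 0"
          using ab c by simp_all
        ultimately have "q' \<in> closed_segment u w"
          unfolding segment_convex_hull convex_hull_2 by blast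
        then have q': "q' \<in> convex hull B"
          using seg by blast
        define s where "s = (t * c - 1) / (c - 1)"
        have s: "0 \<le> s" "s \<le> 1"
          using False c t by (simp_all add: s_def field_simps)
        have "t * c = (1 - s) + s * c"
        proof -
          have "s * (c - 1) = t * c - 1"
            using c by (simp add: s_def)
          then show ?thesis
            by (simp add: algebra_simps)
        qed
        then have "t = (1 - s) * (1 / c) + s"
          using c by (simp add: field_simps)
        then have "z = (1 - s) *\<^sub>R q' + s *\<^sub>R q"
          by (simp add: t(3) q'_def flip: scaleR_left_distrib)
        then have "z \<in> convex hull B"
          using convexD_alt[OF convex_convex_hull q' q(1)] s by simp
        then show ?thesis ..
      qed
    qed
  qed
qed

text \<open>Strict convexity of the ball: inside a segment the distance to \<open>c\<close> is less
  than at one of its ends.\<close>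

lemma extreme_point_of_convex_hull_sphere:
  fixes B :: "'a::euclidean_space set"
  assumes "B \<subseteq> sphere c r"
  shows "a extreme_point_of (convex hull B) \<longleftrightarrow> a \<in> B"
proof
  assume a: "a \<in> B"
  have sub: "convex hull B \<subseteq> cball c r"
    using assms by (intro hull_minimal) auto
  show "a extreme_point_of (convex hull B)"
    unfolding extreme_point_of_def
  proof (intro conjI ballI notI)
    fix x y assume xy: "x \<in> convex hull B" "y \<in> convex hull B" "a \<in> open_segment x y"
    have "dist c a < dist c x \<or> dist c a < dist c y"
      using xy(3) dist_decreases_open_segment by blast
    then show False
      using xy sub a assms by force
  qed (use a in \<open>rule hull_inc\<close>)
qed (rule extreme_point_of_convex_hull)

text \<open>All points of \<open>B\<close> are extreme, so none of \<open>x\<close>,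
  \<open>y\<close>, \<open>z\<close> is between the others, and they span a genuine
  triangle.\<close>

lemma interior_convex_hull_sphere:
  fixes B :: "complex set"
  assumes "B \<subseteq> sphere c r" "x \<in> B" "y \<in> B" "z \<in> B" "x \<noteq> y" "y \<noteq> z" "x \<noteq> z"
  shows "interior (convex hull B) \<noteq> {}"
proof -
  have ext: "a extreme_point_of (convex hull B)" if "a \<in> B" for a
    using that assms(1) by (simp add: extreme_point_of_convex_hull_sphere)
  have nbetween: "\<not> between (b, d) a" if "a \<in> B" "b \<in> B" "d \<in> B" "a \<noteq> b" "a \<noteq> d" for a b d
    using ext[OF that(1)] that hull_inc[of b B convex] hull_inc[of d B convex]
    unfolding between_mem_segment extreme_point_of_def open_segment_def by blast
  have "\<not> collinear {x, y, z}"
    using assms nbetween by (auto simp: collinear_between_cases)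
  then have "\<not> affine_dependent {x, y, z}"
    by (simp add: collinear_3_eq_affine_dependent)
  then have "interior (convex hull {x, y, z}) \<noteq> {}"
    using assms by (subst interior_convex_hull_eq_empty) auto
  moreover have "interior (convex hull {x, y, z}) \<subseteq> interior (convex hull B)"
    using assms by (intro interior_mono hull_mono) auto
  ultimately show ?thesis
    by blast
qed

text \<open>Separation is applied to the interior, since \<open>0\<close> may lie on the boundary of
  the hull; the closure of the interior then recovers the hull.\<close>

lemma supporting_halfspace:
  fixes B :: "'a::euclidean_space set"
  assumes "finite B" "interior (convex hull B) \<noteq> {}" "0 \<notin> interior (convex hull B)"
  shows "\<exists>n. norm n = 1 \<and> (\<forall>a\<in>B. n \<bullet> a \<le> 0)"
proof -
  have "convex (interior (convex hull B))"
    by simp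
  then obtain m where m: "m \<noteq> 0" "\<forall>x\<in>interior (convex hull B). 0 \<le> m \<bullet> x"
    using separating_hyperplane_set_0[OF _ assms(3)] by blast
  have "closure (interior (convex hull B)) \<subseteq> {x. 0 \<le> m \<bullet> x}"
    using m by (intro closure_minimal) (auto simp: closed_halfspace_ge)
  then have "convex hull B \<subseteq> {x. 0 \<le> m \<bullet> x}"
    using convex_closure_interior[OF convex_convex_hull assms(2)] closure_subset by auto
  then have "\<forall>a\<in>B. 0 \<le> m \<bullet> a"
    by (auto intro: hull_inc)
  then show ?thesis
    using m(1) by (intro exI[of _ "(- 1 / norm m) *\<^sub>R m"]) (auto simp: divide_simps)
qed

section \<open>Vertices of the Voronoi tessellation\<close>

text \<open>\<open>cosh (dist p z)\<close> is a combination of \<open>cosh (dist a z)\<close> and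
  \<open>cosh (dist b z)\<close> with nonnegative weights independent of \<open>z\<close>; so half
  planes bounded by bisectors are convex.\<close>

lemma dist_le_geodesic_arc:
  assumes "p \<in> geodesic_arc a b" "dist a x \<le> dist a y" "dist b x \<le> dist b y"
  shows "dist p x \<le> dist p y"
proof -
  obtain s t where st: "s \<ge> 0" "t \<ge> 0"
    and p: "Rep_hyp_plane p = s *\<^sub>R Rep_hyp_plane a + t *\<^sub>R Rep_hyp_plane b"
    using assms(1) by (auto simp: geodesic_arc_iff_cone)
  have cosh: "cosh (dist p z) = s * cosh (dist a z) + t * cosh (dist b z)" for z
    by (simp add: cosh_dist p minkowski_lincomb)
  show ?thesis
    using assms(2,3) st unfolding dist_le_iff_cosh cosh by (intro add_mono mult_left_mono)
qed

lemma hyp_convex_voronoi_cell: "hyp_convex (voronoi_cell S x)"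
  unfolding hyp_convex_def voronoi_cell_def using dist_le_geodesic_arc by blast

lemma closed_voronoi_cell: "closed (voronoi_cell S x)"
proof -
  have "voronoi_cell S x = (\<Inter>y\<in>S - {x}. {p. dist p x \<le> dist p y})"
    by (auto simp: voronoi_cell_def)
  then show ?thesis
    by (auto intro!: closed_INT closed_Collect_le continuous_intros)
qed

lemma geodesic_arc_commute: "geodesic_arc x y = geodesic_arc y x"
  by (auto simp: geodesic_arc_def dist_commute)

lemma geodesic_arc_left: "x \<in> geodesic_arc x y"
  by (simp add: geodesic_arc_def)

lemma infdist_mono_point:
  assumes "K \<noteq> {}" "\<And>q. q \<in> K \<Longrightarrow> dist a q \<le> dist b q"
  shows "infdist a K \<le> infdist b K"
  unfolding infdist_notempty[OF assms(1), of b]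
  using assms by (intro cINF_greatest) (auto intro: infdist_le2)

lemma dist_le_iff_norm_klein: "dist v p \<le> dist v q \<longleftrightarrow> norm (klein v p) \<le> norm (klein v q)"
proof -
  have c: "(cosh (dist v p))\<^sup>2 = 1 / (1 - (norm (klein v p))\<^sup>2)" "1 - (norm (klein v p))\<^sup>2 > 0" for p
  proof -
    show "1 - (norm (klein v p))\<^sup>2 > 0"
      using norm_klein_less_1[of v p] by (simp add: power_less_one_iff)
    then show "(cosh (dist v p))\<^sup>2 = 1 / (1 - (norm (klein v p))\<^sup>2)"
      using cosh_dist_norm_klein[of v p] by (simp add: field_simps)
  qed
  have "dist v p \<le> dist v q \<longleftrightarrow> (cosh (dist v p))\<^sup>2 \<le> (cosh (dist v q))\<^sup>2"
    by (simp add: dist_le_iff_cosh power_mono_iff)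
  also have "\<dots> \<longleftrightarrow> 1 - (norm (klein v q))\<^sup>2 \<le> 1 - (norm (klein v p))\<^sup>2"
    unfolding c(1) using c(2)[of p] c(2)[of q] by (simp add: field_simps)
  also have "\<dots> \<longleftrightarrow> norm (klein v p) \<le> norm (klein v q)"
    by (simp add: power_mono_iff)
  finally show ?thesis .
qed

lemma extreme_points_ray:
  assumes e: "\<And>q. q \<in> e \<Longrightarrow> \<exists>t\<in>{lo..hi}. klein v q = t *\<^sub>R n" and n: "norm n = 1"
    and p: "p \<in> e" "klein v p = T *\<^sub>R n" "T = lo \<or> T = hi"
  shows "p \<in> extreme_points e"
  unfolding extreme_points_def
proof (intro CollectI conjI ballI impI p(1))
  fix a b assume ab: "a \<in> e" "b \<in> e" "p \<in> geodesic_arc a b"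
  then obtain s t where s: "s \<in> {lo..hi}" "klein v a = s *\<^sub>R n" and t: "t \<in> {lo..hi}" "klein v b = t *\<^sub>R n"
    using e by meson
  have "T *\<^sub>R n \<in> closed_segment (s *\<^sub>R n) (t *\<^sub>R n)"
    using ab(3) by (simp add: klein_geodesic_arc_iff[of _ _ _ v] s t p)
  then obtain \<mu> where \<mu>: "0 \<le> \<mu>" "\<mu> \<le> 1" "T *\<^sub>R n = (1 - \<mu>) *\<^sub>R s *\<^sub>R n + \<mu> *\<^sub>R t *\<^sub>R n"
    by (auto simp: closed_segment_def)
  have "n \<noteq> 0"
    using n by auto
  with \<mu>(3) have T: "T = (1 - \<mu>) * s + \<mu> * t"
    by (simp flip: scaleR_left_distrib)
  have "T = s \<or> T = t"
  proof -
    have "T \<in> closed_segment s t"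
      using T \<mu> by (auto simp: closed_segment_def)
    with s(1) t(1) p(3) show ?thesis
      by (auto simp: closed_segment_eq_real_ivl split: if_splits)
  qed
  then have "klein v p = klein v a \<or> klein v p = klein v b"
    by (auto simp: p s t)
  then show "p = a \<or> p = b"
    by simp
qed

section \<open>The sites around a fixed vertex and their polygon\<close>

locale voronoi_vertex =
  fixes S :: "hyp_plane set" and v :: hyp_plane
  assumes closed_S: "closed S" and discrete_S: "discrete S" and vertex: "v \<in> voronoi_vertices S"
begin

abbreviation k :: "hyp_plane \<Rightarrow> complex" where
  "k \<equiv> klein v"

definition A :: "hyp_plane set" where
  "A = {x \<in> S. v \<in> voronoi_cell S x}"

text \<open>The Euclidean radius in the Klein disc, that is \<open>tanh J\<^sub>v\<close>.\<close>

definition radius :: real where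
  "radius = norm (k (SOME x. x \<in> A))"

abbreviation B :: "complex set" where
  "B \<equiv> k ` A"

lemma A_subset: "A \<subseteq> S"
  by (auto simp: A_def)

lemma three_sites:
  obtains x y z where "x \<in> A" "y \<in> A" "z \<in> A" "x \<noteq> y" "y \<noteq> z" "x \<noteq> z"
proof -
  obtain x y z where "x \<in> S" "y \<in> S" "z \<in> S" "x \<noteq> y" "y \<noteq> z" "x \<noteq> z"
    and *: "voronoi_cell S x \<inter> voronoi_cell S y \<inter> voronoi_cell S z = {v}"
    using vertex by (auto simp: voronoi_vertices_def)
  moreover have "v \<in> voronoi_cell S x" "v \<in> voronoi_cell S y" "v \<in> voronoi_cell S z"
    using * by blast+
  ultimately show thesis
    by (intro that[of x y z]) (auto simp: A_def)
qed

lemma third_site: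
  obtains z where "z \<in> A" "z \<noteq> x" "z \<noteq> y"
  by (rule three_sites) metis

lemma dist_site_le: "x \<in> A \<Longrightarrow> y \<in> S \<Longrightarrow> dist v x \<le> dist v y"
  by (cases "x = y") (auto simp: A_def voronoi_cell_def)

lemma dist_sites_eq: "x \<in> A \<Longrightarrow> y \<in> A \<Longrightarrow> dist v x = dist v y"
  using dist_site_le A_subset by (meson antisym subsetD)

lemma dist_nonsite_gt: "x \<in> A \<Longrightarrow> y \<in> S \<Longrightarrow> y \<notin> A \<Longrightarrow> dist v x < dist v y"
  using dist_site_le[of x] by (force simp: A_def voronoi_cell_def)

lemma norm_klein_site: "x \<in> A \<Longrightarrow> norm (k x) = radius"
proof -
  assume x: "x \<in> A"
  then have "(SOME x. x \<in> A) \<in> A"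
    by (rule someI)
  with x show ?thesis
    using dist_le_iff_norm_klein dist_sites_eq unfolding radius_def by (metis antisym order_refl)
qed

lemma B_subset_sphere: "B \<subseteq> sphere 0 radius"
  using norm_klein_site by auto

lemma finite_A: "finite A"
proof -
  obtain x where x: "x \<in> A"
    by (rule three_sites)
  have "A \<subseteq> S \<inter> cball v (dist v x)"
    using A_subset by (auto simp: dist_sites_eq[OF _ x])
  then show ?thesis
    by (rule finite_subset) (rule finite_Int_cball[OF closed_S discrete_S])
qed

text \<open>Sites in \<open>A\<close> are equally far from \<open>v\<close>, so the factors in the
  law of cosines cancel.\<close>

lemma dist_sites_le_iff:
  assumes "x \<in> A" "y \<in> A"
  shows "dist p x \<le> dist p y \<longleftrightarrow> k p \<bullet> k y \<le> k p \<bullet> k x"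
proof -
  have "dist p x \<le> dist p y \<longleftrightarrow>
      (cosh (dist v p) * cosh (dist v y)) * (1 - k p \<bullet> k x) \<le>
      (cosh (dist v p) * cosh (dist v y)) * (1 - k p \<bullet> k y)"
    unfolding dist_le_iff_cosh cosh_dist_klein[of p _ v] dist_sites_eq[OF assms] ..
  also have "\<dots> \<longleftrightarrow> 1 - k p \<bullet> k x \<le> 1 - k p \<bullet> k y"
    by (rule mult_le_cancel_left_pos) simp
  finally show ?thesis
    by simp
qed

lemma voronoi_cell_site_le:
  assumes "p \<in> voronoi_cell S x" "x \<in> A" "a \<in> A"
  shows "k p \<bullet> k a \<le> k p \<bullet> k x"
proof (cases "a = x")
  case False
  with assms A_subset show ?thesis
    unfolding dist_sites_le_iff[OF assms(2,3), symmetric] by (auto simp: voronoi_cell_def)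
qed simp

text \<open>Only finitely many sites lie within \<open>J + 1\<close> of \<open>v\<close>, so those
  outside \<open>A\<close> are farther away than those in \<open>A\<close> by a uniform gap
  \<open>2 * \<delta>\<close>. Within \<open>\<delta>\<close> of \<open>v\<close> they are never
  nearest.\<close>

lemma voronoi_cell_near_vertex:
  "\<exists>\<delta>>0. \<forall>p x. dist v p < \<delta> \<longrightarrow> x \<in> A \<longrightarrow> (\<forall>a\<in>A. k p \<bullet> k a \<le> k p \<bullet> k x) \<longrightarrow>
      p \<in> voronoi_cell S x"
proof -
  obtain x\<^sub>0 where x\<^sub>0: "x\<^sub>0 \<in> A"
    by (rule three_sites)
  define J where "J = dist v x\<^sub>0"
  define C where "C = S \<inter> cball v (J + 1) - A"
  have C: "finite C"
    unfolding C_def by (intro finite_Diff finite_Int_cball closed_S discrete_S)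
  \<comment> \<open>The entry \<open>1/2\<close> keeps \<open>J + 2 * \<delta>\<close> at most
    \<open>J + 1\<close>, for the sites outside the ball, and serves if \<open>C\<close> is
    empty.\<close>
  define \<delta> where "\<delta> = Min (insert (1/2) ((\<lambda>y. (dist v y - J) / 2) ` C))"
  have "\<delta> > 0"
    unfolding \<delta>_def using C dist_nonsite_gt[OF x\<^sub>0] by (subst Min_gr_iff) (auto simp: C_def J_def)
  have \<delta>: "\<delta> \<le> 1/2" "\<And>y. y \<in> C \<Longrightarrow> \<delta> \<le> (dist v y - J) / 2"
    unfolding \<delta>_def using C by (intro Min_le; simp)+
  have far: "J + 2 * \<delta> \<le> dist v y" if "y \<in> S" "y \<notin> A" for y
  proof (cases "y \<in> C")
    case True
    with \<delta>(2)[of y] show ?thesis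
      by (simp add: field_simps)
  next
    case False
    with that \<delta>(1) show ?thesis
      by (auto simp: C_def)
  qed
  show ?thesis
  proof (intro exI[of _ \<delta>] conjI allI impI \<open>\<delta> > 0\<close>)
    fix p x assume p: "dist v p < \<delta>" and x: "x \<in> A"
      and max: "\<forall>a\<in>A. k p \<bullet> k a \<le> k p \<bullet> k x"
    show "p \<in> voronoi_cell S x"
      unfolding voronoi_cell_def
    proof (intro CollectI ballI)
      fix y assume y: "y \<in> S - {x}"
      show "dist p x \<le> dist p y"
      proof (cases "y \<in> A")
        case True
        with max x show ?thesis
          by (simp add: dist_sites_le_iff)
      next
        case False
        have "dist v x = J"
          using dist_sites_eq[OF x x\<^sub>0] by (simp add: J_def)
        moreover have "dist p x \<le> dist v p + dist v x" "dist v y \<le> dist v p + dist p y"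
          using dist_triangle[of p x v] dist_triangle[of v y p] by (simp_all add: dist_commute)
        ultimately show ?thesis
          using far[of y] y False p by simp
      qed
    qed
  qed
qed

lemma vertex_polygon_eq: "vertex_polygon S v = hyp_convex_hull A"
  by (simp add: vertex_polygon_def A_def)

lemma klein_vertex_polygon: "k ` vertex_polygon S v = convex hull B"
  by (simp add: vertex_polygon_eq klein_hyp_convex_hull)

lemma extreme_points_vertex_polygon: "extreme_points (vertex_polygon S v) = A"
  using extreme_point_of_convex_hull_sphere[OF B_subset_sphere]
  by (auto simp: extreme_points_iff_klein[of _ _ v] klein_vertex_polygon image_iff)

lemma interior_convex_hull_B: "interior (convex hull B) \<noteq> {}"
proof -
  obtain x y z where "x \<in> A" "y \<in> A" "z \<in> A" "x \<noteq> y" "y \<noteq> z" "x \<noteq> z"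
    by (rule three_sites)
  then show ?thesis
    by (intro interior_convex_hull_sphere[OF B_subset_sphere, of "k x" "k y" "k z"]) auto
qed

lemma klein_interior_iff: "p \<in> interior (vertex_polygon S v) \<longleftrightarrow> k p \<in> interior (convex hull B)"
  by (auto simp: interior_klein_image simp flip: klein_vertex_polygon)

lemma chord_site:
  assumes "supporting_chord B (k x) (k y) n h" "a \<in> A" "n \<bullet> k a = h"
  shows "a = x \<or> a = y"
  using assms chord_endpoints[of n "k x" radius "k y" h "k a"] norm_klein_site
  by (auto simp: supporting_chord_def)

text \<open>Another centre would give all sites the same inner product with a nonzero vector, hence
  put three points of a circle on a line. Needed because \<open>centered_polygon\<close> asks for
  some centre, not for \<open>v\<close>.\<close>

lemma centre_unique:
  assumes "is_centre (vertex_polygon S v) c"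
  shows "c = v"
proof (rule ccontr)
  assume "c \<noteq> v"
  then have kc: "k c \<noteq> 0"
    by simp
  obtain x y z where xyz: "x \<in> A" "y \<in> A" "z \<in> A" "x \<noteq> y" "y \<noteq> z" "x \<noteq> z"
    by (rule three_sites)
  have eq: "k c \<bullet> k a = k c \<bullet> k b" if "a \<in> A" "b \<in> A" for a b
    using assms that dist_sites_le_iff[of a b c] dist_sites_le_iff[of b a c]
    by (auto simp: is_centre_def extreme_points_vertex_polygon)
  have eq': "sgn (k c) \<bullet> k a = sgn (k c) \<bullet> k x" if "a \<in> A" for a
    using eq[OF that xyz(1)] by (simp add: sgn_div_norm)
  have "\<forall>a\<in>A. sgn (k c) \<bullet> k a \<le> sgn (k c) \<bullet> k x"
    by (intro ballI eq_refl eq')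
  then have "supporting_chord B (k x) (k y) (sgn (k c)) (sgn (k c) \<bullet> k x)"
    using xyz kc eq'[OF xyz(2)] by (simp add: supporting_chord_def norm_sgn)
  from chord_site[OF this xyz(3) eq'[OF xyz(3)]] xyz show False
    by auto
qed

lemma compact_convex_vertex_polygon: "compact_convex_polygon (vertex_polygon S v)"
proof -
  obtain w where "w \<in> interior (convex hull B)"
    using interior_convex_hull_B by blast
  moreover have "interior (convex hull B) = k ` interior (vertex_polygon S v)"
    by (metis interior_klein_image klein_vertex_polygon)
  ultimately show ?thesis
    using finite_A unfolding compact_convex_polygon_def vertex_polygon_eq by blast
qed

lemma noncentered_iff: "noncentered_polygon (vertex_polygon S v) \<longleftrightarrow> v \<notin> interior (vertex_polygon S v)"
proof -
  obtain x where x: "x \<in> A"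
    by (rule three_sites)
  have "is_centre (vertex_polygon S v) v"
    unfolding is_centre_def extreme_points_vertex_polygon using dist_sites_eq[OF _ x] by blast
  then show ?thesis
    using centre_unique compact_convex_vertex_polygon
    by (auto simp: noncentered_polygon_def centered_polygon_def cyclic_polygon_def)
qed

text \<open>As \<open>p\<close> is in both cells, \<open>k x\<close> and \<open>k y\<close> maximise
  the inner product with \<open>k p\<close> over \<open>B\<close>.\<close>

lemma dual_imp_chord:
  assumes "geometric_dual S e x y" "v \<in> e" "p \<in> e" "p \<noteq> v"
  shows "x \<in> A" "y \<in> A" "supporting_chord B (k x) (k y) (sgn (k p)) (sgn (k p) \<bullet> k x)"
proof -
  have e: "e = voronoi_cell S x \<inter> voronoi_cell S y" and "x \<noteq> y"
    using assms by (auto simp: geometric_dual_def)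
  show xy: "x \<in> A" "y \<in> A"
    using assms by (auto simp: geometric_dual_def A_def)
  have le: "k p \<bullet> k a \<le> k p \<bullet> k x" "k p \<bullet> k a \<le> k p \<bullet> k y" if "a \<in> A" for a
    using assms(3) xy that unfolding e by (auto intro: voronoi_cell_site_le)
  have "k p \<bullet> k y = k p \<bullet> k x"
    using le xy by (meson antisym)
  moreover have "sgn (k p) \<bullet> z = (k p \<bullet> z) / norm (k p)" for z
    by (simp add: sgn_div_norm divide_inverse_commute)
  moreover have "norm (sgn (k p)) = 1"
    using assms(4) by (simp add: norm_sgn)
  ultimately show "supporting_chord B (k x) (k y) (sgn (k p)) (sgn (k p) \<bullet> k x)"
    using xy le \<open>x \<noteq> y\<close> by (simp add: supporting_chord_def divide_right_mono)
qed

text \<open>\<open>centered_edge\<close> and \<open>initial_vertex\<close> quantify over the pair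
  dual to \<open>e\<close>. A second point of \<open>e\<close> determines it, as the two sites on
  the supporting line normal to that point.\<close>

lemma dual_unique:
  assumes "geometric_dual S e x y" "geometric_dual S e x' y'" "v \<in> e"
  shows "{x, y} = {x', y'}"
proof -
  obtain p where p: "p \<in> e" "p \<noteq> v"
    using assms(1) by (auto simp: geometric_dual_def)
  note c = dual_imp_chord[OF assms(1,3) p] and c' = dual_imp_chord[OF assms(2,3) p]
  have h: "sgn (k p) \<bullet> k x' = sgn (k p) \<bullet> k x" "sgn (k p) \<bullet> k y' = sgn (k p) \<bullet> k x"
    using c c' by (auto simp: supporting_chord_def intro: antisym)
  have "x' = x \<or> x' = y" "y' = x \<or> y' = y"
    using chord_site[OF c(3)] c'(1,2) h by auto
  moreover have "x' \<noteq> y'"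
    using assms(2) by (auto simp: geometric_dual_def)
  ultimately show ?thesis
    by auto
qed

lemma dual_arc_unique:
  assumes "geometric_dual S e x y" "geometric_dual S e x' y'" "v \<in> e"
  shows "geodesic_arc x' y' = geodesic_arc x y"
  using dual_unique[OF assms] geodesic_arc_commute by (auto simp: doubleton_eq_iff)

section \<open>The edge dual to a given side\<close>

context
  fixes x y n h
  assumes xy: "x \<in> A" "y \<in> A" and chord: "supporting_chord B (k x) (k y) n h"
begin

lemma norm_normal: "norm n = 1"
  using chord by (simp add: supporting_chord_def)

lemma normal_inner: "n \<bullet> k x = h" "n \<bullet> k y = h" "a \<in> A \<Longrightarrow> n \<bullet> k a \<le> h"
  using chord by (auto simp: supporting_chord_def)

lemma vertex_in_edge: "v \<in> voronoi_cell S x \<inter> voronoi_cell S y"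
  using xy by (simp add: A_def)

text \<open>Equal distance to \<open>x\<close> and \<open>y\<close> puts \<open>k p\<close> on the
  line through \<open>0\<close> along \<open>n\<close>. A third site has height less than
  \<open>h\<close>, so for \<open>t < 0\<close> it would be nearer to \<open>p\<close> than
  \<open>x\<close> and \<open>y\<close>.\<close>

lemma edge_ray:
  assumes p: "p \<in> voronoi_cell S x \<inter> voronoi_cell S y"
  shows "\<exists>t\<in>{0..1}. k p = t *\<^sub>R n"
proof -
  have n: "norm n = 1"
    by (rule norm_normal)
  have uw: "norm (k x) = radius" "norm (k y) = radius" "k x \<noteq> k y" "n \<bullet> k x = h" "n \<bullet> k y = h"
    using xy chord norm_klein_site by (auto simp: supporting_chord_def)
  note cc = chord_coords[OF n uw]
  have "k p \<bullet> k x = k p \<bullet> k y"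
    using p xy by (intro antisym) (auto intro: voronoi_cell_site_le)
  then have "((\<i> * n) \<bullet> k p) * ((\<i> * n) \<bullet> k x) = 0"
    unfolding inner_frame[OF n, of "k p" "k x"] inner_frame[OF n, of "k p" "k y"] uw cc(1) by simp
  then have tau: "(\<i> * n) \<bullet> k p = 0"
    using cc(2) by simp
  define t where "t = n \<bullet> k p"
  have nn: "n \<bullet> n = 1" "(\<i> * n) \<bullet> n = 0"
    using n by (simp_all add: dot_square_norm) (simp add: inner_complex_def)
  have kp: "k p = t *\<^sub>R n"
    by (rule frame_eqI[OF n]) (simp_all add: nn tau t_def)
  have "t \<ge> 0"
  proof (rule ccontr)
    assume "\<not> t \<ge> 0"
    then have t: "t < 0"
      by simp
    obtain z where z: "z \<in> A" "z \<noteq> x" "z \<noteq> y"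
      by (rule third_site)
    have "k p \<bullet> k z \<le> k p \<bullet> k x"
      using p xy z by (auto intro: voronoi_cell_site_le)
    then have "n \<bullet> k z \<ge> h"
      using t normal_inner by (simp add: kp)
    then have "n \<bullet> k z = h"
      using normal_inner(3)[OF z(1)] by simp
    with chord_site[OF chord z(1)] z show False
      by auto
  qed
  moreover have "\<bar>t\<bar> \<le> 1"
    using norm_klein_less_1[of v p] n by (simp add: kp)
  ultimately show ?thesis
    using kp by auto
qed

lemma vertex_extreme: "v \<in> extreme_points (voronoi_cell S x \<inter> voronoi_cell S y)"
  by (rule extreme_points_ray[where lo = 0 and hi = 1 and n = n and T = 0 and v = v])
    (use edge_ray vertex_in_edge norm_normal in auto)

text \<open>Nondegeneracy is the issue: for small \<open>t > 0\<close> the inner product with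
  \<open>t *\<^sub>R n\<close> is maximal over \<open>B\<close> at \<open>k x\<close> and
  \<open>k y\<close>, so this point lies in both cells.\<close>

lemma geometric_dual_chord: "geometric_dual S (voronoi_cell S x \<inter> voronoi_cell S y) x y"
proof -
  obtain \<delta> where \<delta>: "\<delta> > 0" and cell: "\<And>p x. dist v p < \<delta> \<Longrightarrow> x \<in> A \<Longrightarrow>
      (\<forall>a\<in>A. k p \<bullet> k a \<le> k p \<bullet> k x) \<Longrightarrow> p \<in> voronoi_cell S x"
    using voronoi_cell_near_vertex by blast
  have v0: "klein_inv v 0 = v"
    using klein_inv_klein[of v v] by simp
  obtain \<epsilon> where \<epsilon>: "\<epsilon> > 0"
    "\<And>z. z \<in> ball 0 1 \<Longrightarrow> dist z 0 < \<epsilon> \<Longrightarrow> dist (klein_inv v z) v < \<delta>"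
    using continuous_on_klein_inv[of v] \<delta> unfolding continuous_on_iff
    by (metis v0 centre_in_ball zero_less_one)
  define t where "t = min (\<epsilon> / 2) (1 / 2)"
  have t: "0 < t" "t < \<epsilon>" "t < 1"
    using \<epsilon> by (auto simp: t_def)
  define p where "p = klein_inv v (t *\<^sub>R n)"
  have norm_tn: "norm (t *\<^sub>R n) = t"
    using t norm_normal by simp
  have kp: "k p = t *\<^sub>R n"
    unfolding p_def using norm_tn t by (intro klein_klein_inv) simp
  have near: "dist v p < \<delta>"
    using \<epsilon>(2)[of "t *\<^sub>R n"] norm_tn t by (simp add: p_def dist_commute)
  have "p \<in> voronoi_cell S x" "p \<in> voronoi_cell S y"
    using xy t normal_inner by (auto intro!: cell near simp: kp)
  moreover have "p \<noteq> v"
  proof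
    assume "p = v"
    with kp norm_tn t show False
      by simp
  qed
  moreover have "x \<noteq> y"
    using chord by (auto simp: supporting_chord_def)
  ultimately show ?thesis
    using xy A_subset vertex_in_edge unfolding geometric_dual_def by blast
qed

lemma arc_inner:
  assumes "q \<in> geodesic_arc x y"
  shows "n \<bullet> k q = h"
proof -
  obtain t where "k q = (1 - t) *\<^sub>R k x + t *\<^sub>R k y"
    using assms unfolding klein_geodesic_arc_iff[of _ _ _ v] by (auto simp: closed_segment_def)
  then have "n \<bullet> k q = (1 - t) * h + t * h"
    by (simp only: inner_add_right inner_scaleR_right normal_inner)
  then show ?thesis
    by (simp add: left_diff_distrib)
qed

text \<open>The edge has heights at least \<open>0\<close> and the arc has height
  \<open>h \<le> 0\<close>, so they can meet only at the endpoint \<open>v\<close>. For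
  \<open>w\<close> on the edge and \<open>q\<close> on the arc,
  \<open>k w \<bullet> k q \<le> 0\<close>: the angle at \<open>v\<close> is not acute, so
  \<open>dist v q \<le> dist w q\<close>.\<close>

lemma nonpositive_imp_initial:
  assumes h: "h \<le> 0"
  defines "e \<equiv> voronoi_cell S x \<inter> voronoi_cell S y"
  shows "noncentered_edge S e" "initial_vertex S e v"
proof -
  have dual: "geometric_dual S e x y" and ext: "v \<in> extreme_points e" and ve: "v \<in> e"
    using geometric_dual_chord vertex_extreme vertex_in_edge by (simp_all add: e_def)
  have nn: "n \<bullet> n = 1"
    using norm_normal by (simp add: dot_square_norm)
  have "\<not> centered_edge S e"
  proof
    assume "centered_edge S e"
    then obtain x' y' q where dual': "geometric_dual S e x' y'"
      and q: "q \<in> e" "q \<notin> extreme_points e" "q \<in> geodesic_arc x' y'"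
      by (auto simp: centered_edge_def)
    have "q \<in> geodesic_arc x y"
      using q(3) dual_arc_unique[OF dual dual' ve] by simp
    then have "n \<bullet> k q = h"
      by (rule arc_inner)
    moreover obtain t where t: "t \<ge> 0" "k q = t *\<^sub>R n"
      using edge_ray[of q] q(1) by (auto simp: e_def)
    ultimately have "t = 0"
      using h by (simp add: nn)
    with t have "q = v"
      by simp
    with q ext show False
      by simp
  qed
  then show "noncentered_edge S e"
    using dual by (auto simp: noncentered_edge_def voronoi_edges_def)
  have "infdist v (geodesic_arc x y) \<le> infdist w (geodesic_arc x y)" if "w \<in> extreme_points e" for w
  proof (rule infdist_mono_point)
    show "geodesic_arc x y \<noteq> {}"
      using geodesic_arc_left by blast
    fix q assume q: "q \<in> geodesic_arc x y"
    have "w \<in> e"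
      using that by (simp add: extreme_points_def)
    then obtain t where t: "t \<ge> 0" "k w = t *\<^sub>R n"
      using edge_ray[of w] by (auto simp: e_def)
    have "k w \<bullet> k q = t * h"
      using arc_inner[OF q] by (simp add: t)
    also have "\<dots> \<le> 0"
      using t h by (simp add: mult_nonneg_nonpos)
    finally have "1 * cosh (dist v q) \<le> (cosh (dist v w) * (1 - k w \<bullet> k q)) * cosh (dist v q)"
      by (intro mult_right_mono mult_ge1_I cosh_dist_ge_1) auto
    then have "cosh (dist v q) \<le> cosh (dist w q)"
      by (simp add: cosh_dist_klein[of w q v] mult_ac)
    then show "dist v q \<le> dist w q"
      by (simp add: dist_le_iff_cosh)
  qed
  with dual ext show "initial_vertex S e v"
    by (auto simp: initial_vertex_def)
qed

text \<open>For \<open>h > 0\<close> the edge sets out towards the foot \<open>h *\<^sub>R n\<close>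
  of the perpendicular from \<open>v\<close> to the arc, and its last point on the way contradicts
  the minimality of \<open>v\<close>.\<close>

lemma initial_imp_nonpositive:
  defines "e \<equiv> voronoi_cell S x \<inter> voronoi_cell S y"
  assumes nc: "noncentered_edge S e" and init: "initial_vertex S e v"
  shows "h \<le> 0"
proof (rule ccontr)
  assume "\<not> h \<le> 0"
  then have h0: "h > 0"
    by simp
  have dual: "geometric_dual S e x y" and ve: "v \<in> e"
    using geometric_dual_chord vertex_in_edge by (simp_all add: e_def)
  have n: "norm n = 1"
    by (rule norm_normal)
  have uw: "norm (k x) = radius" "norm (k y) = radius" "k x \<noteq> k y" "n \<bullet> k x = h" "n \<bullet> k y = h"
    using xy chord norm_klein_site by (auto simp: supporting_chord_def)
  have h1: "h < 1"
    using norm_cauchy_schwarz[of n "k x"] norm_klein_less_1[of v x] n uw(4) by simp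
  define pt where "pt = (\<lambda>t. klein_inv v (t *\<^sub>R n))"
  have k_pt: "k (pt t) = t *\<^sub>R n" if "0 \<le> t" "t \<le> h" for t
    unfolding pt_def using that h1 n by (intro klein_klein_inv) simp
  have m_arc: "pt h \<in> geodesic_arc x y"
  proof -
    have "h *\<^sub>R n \<in> closed_segment (k x) (k y)"
      using chord_coords(4)[OF n uw] unfolding closed_segment_def by (auto intro!: exI[of _ "1/2"])
    then show ?thesis
      using h0 by (simp add: klein_geodesic_arc_iff[of _ _ _ v] k_pt)
  qed
  have ray: "\<exists>t\<in>{0..1}. k q = t *\<^sub>R n" if "q \<in> e" for q
    using edge_ray that by (simp add: e_def)
  have convex: "pt s \<in> e" if "q \<in> e" "k q = t *\<^sub>R n" "0 \<le> s" "s \<le> t" "s \<le> h" for q s t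
  proof -
    have "s *\<^sub>R n \<in> closed_segment 0 (t *\<^sub>R n)"
      using that by (cases "t = 0") (auto simp: in_segment intro!: exI[of _ "s / t"])
    then have "pt s \<in> geodesic_arc v q"
      using that by (simp add: klein_geodesic_arc_iff[of _ _ _ v] k_pt)
    moreover have "hyp_convex e"
      using hyp_convex_voronoi_cell by (auto simp: e_def hyp_convex_def)
    ultimately show ?thesis
      using that(1) ve by (auto simp: hyp_convex_def)
  qed
  \<comment> \<open>The parameters up to the foot at which the edge is still present. Cutting off at
    \<open>h\<close> keeps the set compact even if \<open>e\<close> is unbounded.\<close>
  define I where "I = {0..h} \<inter> pt -` e"
  have "continuous_on {0..h} pt"
    unfolding pt_def using h1 n
    by (intro continuous_on_compose2[OF continuous_on_klein_inv] continuous_intros) auto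
  then have "closed I"
    unfolding I_def e_def by (intro continuous_closed_preimage closed_Int closed_voronoi_cell) auto
  then have "compact I"
    unfolding compact_eq_bounded_closed I_def by (auto intro: bounded_subset[of "{0..h}"])
  obtain q where q: "q \<in> e" "q \<noteq> v"
    using dual by (auto simp: geometric_dual_def)
  obtain t where t: "t \<ge> 0" "k q = t *\<^sub>R n"
    using ray[OF q(1)] by auto
  with q have "t > 0"
    by (cases "t = 0") auto
  then have tI: "min t h \<in> I" "min t h > 0"
    using convex[OF q(1) t(2), of "min t h"] h0 by (auto simp: I_def)
  obtain T where T: "T \<in> I" "\<And>s. s \<in> I \<Longrightarrow> s \<le> T"
    using compact_attains_sup[OF \<open>compact I\<close>] tI(1) by blast
  have T0: "0 < T" "T \<le> h"
    using T(2)[OF tI(1)] tI(2) T(1) by (auto simp: I_def)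
  define w where "w = pt T"
  have w: "w \<in> e" "k w = T *\<^sub>R n"
    using T(1) by (auto simp: I_def w_def k_pt)
  \<comment> \<open>An endpoint of \<open>e\<close> strictly nearer to the arc than \<open>v\<close>: going from \<open>v\<close> towards the arc one
    leaves \<open>e\<close> at \<open>w\<close>, or reaches the arc there.\<close>
  have w_ext: "w \<in> extreme_points e"
  proof (cases "T = h")
    case True
    then have "w \<in> geodesic_arc x y"
      using m_arc by (simp add: w_def)
    then show ?thesis
      using nc dual w(1) by (auto simp: noncentered_edge_def centered_edge_def)
  next
    case False
    \<comment> \<open>Were \<open>t > T\<close>, the parameter \<open>min t h\<close> would lie in
      \<open>I\<close> beyond \<open>T\<close>.\<close>
    have "\<exists>t\<in>{0..T}. k q = t *\<^sub>R n" if q: "q \<in> e" for q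
    proof -
      obtain t where t: "t \<in> {0..1}" "k q = t *\<^sub>R n"
        using ray[OF q] by blast
      have "min t h \<in> I"
        using convex[OF q t(2), of "min t h"] t(1) h0 by (auto simp: I_def)
      then have "t \<le> T"
        using T(2) False T0(2) by (force simp: min_def split: if_splits)
      with t show ?thesis
        by auto
    qed
    then show ?thesis
      by (rule extreme_points_ray[where n = n and T = T]) (use n w in auto)
  qed
  obtain x' y' where dual': "geometric_dual S e x' y'"
    and "\<forall>w\<in>extreme_points e. infdist v (geodesic_arc x' y') \<le> infdist w (geodesic_arc x' y')"
    using init by (auto simp: initial_vertex_def)
  then have le: "infdist v (geodesic_arc x y) \<le> infdist w (geodesic_arc x y)"
    using w_ext dual_arc_unique[OF dual dual' ve] by simp
  have "dist v (pt h) \<le> infdist v (geodesic_arc x y)"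
  proof -
    have "dist v (pt h) \<le> dist v q" if "q \<in> geodesic_arc x y" for q
    proof -
      have "h \<le> norm (k q)"
        using norm_cauchy_schwarz[of n "k q"] arc_inner[OF that] n by simp
      then show ?thesis
        using h0 n by (simp add: dist_le_iff_norm_klein k_pt)
    qed
    moreover have "geodesic_arc x y \<noteq> {}"
      using m_arc by blast
    ultimately show ?thesis
      unfolding infdist_notempty[OF \<open>geodesic_arc x y \<noteq> {}\<close>] by (intro cINF_greatest)
  qed
  moreover have "infdist w (geodesic_arc x y) \<le> dist w (pt h)"
    using m_arc by (rule infdist_le)
  moreover have "dist w (pt h) < dist v (pt h)"
  proof -
    have T1: "T < 1"
      using T0 h1 by simp
    \<comment> \<open>The aim is \<open>(1 - T * h)\<^sup>2 < 1 - T\<^sup>2\<close>, which by the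
      law of cosines says that \<open>w\<close> is nearer to the foot than \<open>v\<close>;
      expanded, it is \<open>T\<close> times \<open>T * (1 + h\<^sup>2) < h * 2\<close>.\<close>
    have "T * (1 + h\<^sup>2) \<le> h * (1 + h\<^sup>2)"
      using T0 by (intro mult_right_mono) auto
    also have "\<dots> < h * 2"
      using h0 h1 by (intro mult_strict_left_mono) (auto simp: power_less_one_iff)
    finally have "T * (T * (1 + h\<^sup>2)) < T * (h * 2)"
      using T0 by (intro mult_strict_left_mono)
    then have "(1 - T * h)\<^sup>2 < 1 - T\<^sup>2"
      by (simp add: power2_eq_square algebra_simps)
    then have "1 - T * h < sqrt (1 - T\<^sup>2)"
      by (rule real_less_rsqrt)
    then have "1 / sqrt (1 - T\<^sup>2) * (1 - T * h) < 1"
      using T0 T1 by (simp add: divide_less_eq power_less_one_iff)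
    moreover have "cosh (dist v w) = 1 / sqrt (1 - T\<^sup>2)"
      using cosh_dist_klein_inv[of "T *\<^sub>R n" v] T0 T1 n by (simp add: w_def pt_def)
    moreover have "k w \<bullet> k (pt h) = T * h"
      using w(2) h0 n by (simp add: k_pt dot_square_norm)
    ultimately have "cosh (dist v w) * (1 - k w \<bullet> k (pt h)) * cosh (dist v (pt h))
        < 1 * cosh (dist v (pt h))"
      by (intro mult_strict_right_mono) auto
    then have "cosh (dist w (pt h)) < cosh (dist v (pt h))"
      by (simp add: cosh_dist_klein[of w "pt h" v] mult_ac)
    then show ?thesis
      by (simp add: dist_less_iff_cosh)
  qed
  ultimately show False
    using le by linarith
qed

section \<open>The longest edge and the adjoined triangle\<close>

lemma interior_inner_less:
  assumes "z \<in> interior (convex hull B)"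
  shows "n \<bullet> z < h"
proof -
  have "convex hull B \<subseteq> {z. n \<bullet> z \<le> h}"
    by (intro hull_minimal convex_halfspace_le) (auto simp: normal_inner)
  then have "interior (convex hull B) \<subseteq> interior {z. n \<bullet> z \<le> h}"
    by (rule interior_mono)
  also have "\<dots> = {z. n \<bullet> z < h}"
    using norm_normal by (intro interior_halfspace_le) auto
  finally show ?thesis
    using assms by blast
qed

lemma chord_polygon_edge: "polygon_edge (vertex_polygon S v) x y"
proof -
  have "geodesic_arc x y \<subseteq> frontier (vertex_polygon S v)"
  proof
    fix q assume q: "q \<in> geodesic_arc x y"
    have "k q \<in> closed_segment (k x) (k y)"
      using q by (simp flip: klein_geodesic_arc_iff)
    also have "\<dots> \<subseteq> convex hull B"
      using xy by (intro closed_segment_subset hull_inc convex_convex_hull) auto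
    finally have "q \<in> vertex_polygon S v"
      unfolding klein_vertex_polygon[symmetric] by auto
    moreover have "q \<notin> interior (vertex_polygon S v)"
      using arc_inner[OF q] interior_inner_less[of "k q"] by (auto simp: klein_interior_iff)
    ultimately show "q \<in> frontier (vertex_polygon S v)"
      using closure_subset by (auto simp: frontier_def)
  qed
  then show ?thesis
    using xy chord by (auto simp: polygon_edge_def extreme_points_vertex_polygon supporting_chord_def)
qed

text \<open>Covers edges and diagonals alike, so the edges of the polygon need not be
  determined.\<close>

lemma chord_longest:
  assumes "h \<le> 0" "a \<in> A" "b \<in> A" "{a, b} \<noteq> {x, y}"
  shows "dist a b < dist x y"
proof -
  have "{k a, k b} \<noteq> {k x, k y}"
    using assms(4) by (auto simp: doubleton_eq_iff)
  then have "k x \<bullet> k y < k a \<bullet> k b"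
    using assms by (intro longest_chord[OF chord B_subset_sphere]) auto
  moreover have "dist v a = dist v x" "dist v b = dist v y"
    using assms xy dist_sites_eq by blast+
  ultimately have "cosh (dist a b) < cosh (dist x y)"
    unfolding cosh_dist_klein[of a b v] cosh_dist_klein[of x y v] by simp
  then show ?thesis
    by (simp add: dist_less_iff_cosh)
qed

text \<open>The union is the hull of the sites and \<open>v\<close>. Its interior contains that of
  \<open>vertex_polygon S v\<close>, so a degenerate triangle needs no separate treatment.\<close>

lemma polygon_Un_triangle:
  assumes "h \<le> 0"
  shows "compact_convex_polygon (vertex_polygon S v \<union> dual_triangle x y v)"
proof -
  have "k ` (vertex_polygon S v \<union> dual_triangle x y v) = convex hull B \<union> convex hull {0, k x, k y}"
    by (simp add: image_Un klein_vertex_polygon dual_triangle_def klein_hyp_convex_hull)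
  also have "\<dots> = convex hull (insert 0 B)"
    by (rule convex_hull_Un_triangle[OF chord B_subset_sphere assms])
  also have "\<dots> = k ` (hyp_convex_hull (insert v A))"
    by (simp add: klein_hyp_convex_hull)
  finally have "vertex_polygon S v \<union> dual_triangle x y v = hyp_convex_hull (insert v A)"
    by (simp add: inj_image_eq_iff[OF inj_klein])
  moreover have "interior (vertex_polygon S v) \<subseteq> interior (vertex_polygon S v \<union> dual_triangle x y v)"
    by (intro interior_mono) auto
  moreover have "interior (vertex_polygon S v) \<noteq> {}"
    using compact_convex_vertex_polygon by (simp add: compact_convex_polygon_def)
  ultimately show ?thesis
    using finite_A unfolding compact_convex_polygon_def by (metis finite_insert subset_empty)
qed

end

lemma initial_dual_chord:
  assumes "noncentered_edge S e" "initial_vertex S e v" "geometric_dual S e x y"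
  obtains n h where "x \<in> A" "y \<in> A" "supporting_chord B (k x) (k y) n h" "h \<le> 0"
proof -
  have ve: "v \<in> e"
    using assms(2) by (auto simp: initial_vertex_def extreme_points_def)
  obtain p where "p \<in> e" "p \<noteq> v"
    using assms(3) by (auto simp: geometric_dual_def)
  note c = dual_imp_chord[OF assms(3) ve this]
  have "e = voronoi_cell S x \<inter> voronoi_cell S y"
    using assms(3) by (simp add: geometric_dual_def)
  then have "sgn (k p) \<bullet> k x \<le> 0"
    using initial_imp_nonpositive[OF c] assms by simp
  with c that show thesis
    by blast
qed

end

theorem lemma3p3:
  fixes S :: "hyp_plane set" and v :: hyp_plane
  assumes "closed S" and "discrete S" and "v \<in> voronoi_vertices S"
  shows "(noncentered_polygon (vertex_polygon S v) \<longleftrightarrow>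
            (\<exists>e. noncentered_edge S e \<and> initial_vertex S e v)) \<and>
         (\<forall>e x y. noncentered_edge S e \<and> initial_vertex S e v \<and> geometric_dual S e x y \<longrightarrow>
            unique_longest_edge (vertex_polygon S v) x y \<and>
            compact_convex_polygon (vertex_polygon S v \<union> dual_triangle x y v))"
proof -
  interpret voronoi_vertex S v
    using assms by unfold_locales
  show ?thesis
  proof (intro conjI allI impI iffI)
    assume "noncentered_polygon (vertex_polygon S v)"
    then have "0 \<notin> interior (convex hull B)"
      by (simp add: noncentered_iff klein_interior_iff)
    then obtain n where n: "norm n = 1" "\<forall>a\<in>B. n \<bullet> a \<le> 0"
      using supporting_halfspace[OF _ interior_convex_hull_B] finite_A by blast
    obtain x y z where "x \<in> A" "y \<in> A" "x \<noteq> y"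
      by (rule three_sites)
    then obtain u w n' h where uw: "supporting_chord B u w n' h" and h: "h \<le> 0"
      using supporting_chord_exists[OF _ B_subset_sphere _ _ _ n(1), of "k x" "k y"] n(2) finite_A
      by auto
    then obtain x y where xy: "x \<in> A" "y \<in> A" "u = k x" "w = k y"
      by (auto simp: supporting_chord_def)
    then show "\<exists>e. noncentered_edge S e \<and> initial_vertex S e v"
      using nonpositive_imp_initial[OF xy(1,2) _ h] uw by blast
  next
    assume "\<exists>e. noncentered_edge S e \<and> initial_vertex S e v"
    then obtain e where e: "noncentered_edge S e" "initial_vertex S e v"
      by blast
    then obtain x y where "geometric_dual S e x y"
      unfolding initial_vertex_def by blast
    with e obtain n h where "x \<in> A" "y \<in> A" "supporting_chord B (k x) (k y) n h" "h \<le> 0"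
      by (rule initial_dual_chord)
    \<comment> \<open>If \<open>0\<close> were interior, its height \<open>0\<close> would be less
      than \<open>h\<close>.\<close>
    then show "noncentered_polygon (vertex_polygon S v)"
      using interior_inner_less[of x y n h 0] by (auto simp: noncentered_iff klein_interior_iff)
  next
    fix e x y
    assume "noncentered_edge S e \<and> initial_vertex S e v \<and> geometric_dual S e x y"
    then obtain n h where *: "x \<in> A" "y \<in> A" "supporting_chord B (k x) (k y) n h" "h \<le> 0"
      using initial_dual_chord by metis
    show "unique_longest_edge (vertex_polygon S v) x y"
      using chord_polygon_edge[OF *(1-3)] chord_longest[OF *]
      by (auto simp: unique_longest_edge_def polygon_edge_def extreme_points_vertex_polygon)
    show "compact_convex_polygon (vertex_polygon S v \<union> dual_triangle x y v)"
      by (rule polygon_Un_triangle[OF *])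
  qed
qed

end
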